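(* Let $n$ be a positive odd integer, and let $M=(n-1)/2$ or $M=n-1$. Then $$\sum_{k=0}^{M}[4k+1]\frac{(q;q^2)_k^4}{(q^2;q^2)_k^4}q^{-2k^2-k}\equiv[n]q^{(1-n)/2}\left\{1+[n]^2\frac{(n^2-1)(1-q)^2}{24}\right\}\sum_{k=0}^{(n-1)/2}\frac{(q;q^2)_k^3}{(q^2;q^2)_k^2}(-q)^{-k^2}\pmod{[n]\Phi_n(q)^3}.$$
   Context: For a nonnegative integer $k$, $(x;q)_0=1$ and $(x;q)_k=(1-x)(1-xq)\cdots(1-xq^{k-1})$ for $k\ge 1$; the same notation is used with base $q$ replaced by $q^2$. $[m]=(1-q^m)/(1-q)$, and $\Phi_n(q)$ is the $n$-th cyclotomic polynomial in $q$. For rational functions $A,B\in\mathbb{Q}(q)$ and a polynomial $P\in\mathbb{Q}[q]$, $A\equiv B\pmod P$ means that $A-B$, written in lowest terms, has numerator divisible by $P$. *)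

theory Defs
  imports Complex_Main "HOL-Computational_Algebra.Computational_Algebra"
    "HOL-Computational_Algebra.Field_as_Ring"
begin

text \<open>The field $\mathbf{Q}(q)$ is \<^typ>\<open>rat poly fract\<close>; its generator:\<close>

definition qvar :: "rat poly fract"  ("\<q>")
  where "\<q> = to_fract [:0, 1:]"

definition qpoch :: "'a::comm_ring_1 \<Rightarrow> 'a \<Rightarrow> nat \<Rightarrow> 'a"
  where "qpoch x q k = (\<Prod>i<k. 1 - x * q ^ i)"

text \<open>
  The constant \<^term>\<open>(div)\<close> is ordinary division in a field, and exact division in the ring
  of polynomials. Hence \<^term>\<open>qnum \<q> m\<close> is $[m]$ as a rational function, and
  \<^term>\<open>qnum [:0, 1 :: rat:] m\<close> is $[m]$ as a polynomial, as needed for a modulus.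
\<close>

definition qnum :: "'a::idom_divide \<Rightarrow> nat \<Rightarrow> 'a"
  where "qnum q m = (1 - q ^ m) div (1 - q)"

lemma qnum_field: "qnum (x :: 'a::field) m = (1 - x ^ m) / (1 - x)"
  by (simp add: qnum_def)

lemma qnum_eq_sum:
  fixes x :: "'a::idom_divide"
  assumes "x \<noteq> 1"
  shows "qnum x m = (\<Sum>i<m. x ^ i)"
  using assms by (simp add: qnum_def one_diff_power_eq)

lemma qvar_neq_1: "\<q> \<noteq> 1"
proof
  assume "\<q> = 1"
  then have "to_fract [:0, 1 :: rat:] = to_fract 1"
    by (simp add: qvar_def)
  then have "[:0, 1 :: rat:] = 1"
    by (simp only: to_fract_eq_iff)
  then show False
    by (simp add: one_pCons)
qed

lemma to_fract_power': "to_fract (p ^ i) = to_fract p ^ i"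
  by (induction i) simp_all

lemma to_fract_sum': "to_fract (\<Sum>i\<in>A. f i) = (\<Sum>i\<in>A. to_fract (f i))"
  by (induction A rule: infinite_finite_induct) simp_all

lemma to_fract_qnum: "to_fract (qnum [:0, 1 :: rat:] m) = qnum \<q> m"
proof -
  have "[:0, 1 :: rat:] \<noteq> 1"
    by (simp add: one_pCons)
  with qvar_neq_1 show ?thesis
    by (simp add: qnum_eq_sum to_fract_sum' to_fract_power' qvar_def)
qed

definition ratfun_cong :: "rat poly fract \<Rightarrow> rat poly fract \<Rightarrow> rat poly \<Rightarrow> bool"
  where "ratfun_cong A B P \<longleftrightarrow> P dvd fst (quot_of_fract (A - B))"

definition primitive_roots_unity :: "nat \<Rightarrow> complex set"
  where "primitive_roots_unity n = {z. z ^ n = 1 \<and> (\<forall>m. 0 < m \<and> m < n \<longrightarrow> z ^ m \<noteq> 1)}"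

text \<open>
  The product of the linear factors over the primitive roots of unity has rational coefficients
  (see \<open>map_poly_cyclotomic\<close> below), so for positive \<open>n\<close> the description is proper.
\<close>

definition cyclotomic :: "nat \<Rightarrow> rat poly"
  where "cyclotomic n =
    (THE P. map_poly of_rat P = (\<Prod>z\<in>primitive_roots_unity n. [:- z, 1:]))"

lemma map_poly_of_rat_add:
  "map_poly of_rat (p + r) = (map_poly of_rat p + map_poly of_rat r :: complex poly)"
  by (rule poly_eqI) (simp add: coeff_map_poly of_rat_add)

lemma map_poly_of_rat_diff:
  "map_poly of_rat (p - r) = (map_poly of_rat p - map_poly of_rat r :: complex poly)"
  by (rule poly_eqI) (simp add: coeff_map_poly of_rat_diff)

lemma map_poly_of_rat_mult:
  "map_poly of_rat (p * r) = (map_poly of_rat p * map_poly of_rat r :: complex poly)"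
  by (rule poly_eqI) (simp add: coeff_map_poly coeff_mult of_rat_sum of_rat_mult)

lemma map_poly_of_rat_prod:
  "map_poly of_rat (\<Prod>i\<in>A. f i) = (\<Prod>i\<in>A. map_poly of_rat (f i) :: complex poly)"
  by (induction A rule: infinite_finite_induct) (simp_all add: map_poly_of_rat_mult)

lemma map_poly_of_rat_eq_iff:
  "map_poly of_rat p = (map_poly of_rat r :: complex poly) \<longleftrightarrow> p = r"
  by (simp add: poly_eq_iff coeff_map_poly)

lemma map_poly_of_rat_dvdD:
  assumes "(map_poly of_rat p :: complex poly) dvd map_poly of_rat r"
  shows "p dvd r"
proof (cases "p = 0")
  case True
  with assms show ?thesis
    using map_poly_of_rat_eq_iff[of r 0] by simp
next
  case False
  let ?h = "map_poly of_rat :: rat poly \<Rightarrow> complex poly"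
  have deg: "degree (?h s) = degree s" for s
    by (rule degree_map_poly) auto
  have "?h r = ?h (r div p) * ?h p + ?h (r mod p)"
    by (metis div_mult_mod_eq map_poly_of_rat_add map_poly_of_rat_mult)
  then have "?h p dvd ?h (r mod p)"
    using assms by (metis dvd_add_right_iff dvd_triv_right)
  then have "r mod p = 0"
    using False degree_mod_less[of p r] deg dvd_imp_degree_le[of "?h p" "?h (r mod p)"]
      map_poly_of_rat_eq_iff[of "r mod p" 0] by fastforce
  then show ?thesis
    by (simp add: mod_eq_0_iff_dvd)
qed

lemma finite_primitive_roots_unity:
  assumes "n > 0"
  shows "finite (primitive_roots_unity n)"
proof (rule finite_subset)
  show "primitive_roots_unity n \<subseteq> {z. z ^ n = 1}"
    by (auto simp: primitive_roots_unity_def)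
  show "finite {z :: complex. z ^ n = 1}"
    using assms by (simp add: finite_roots_unity Suc_leI)
qed

lemma primitive_roots_unity_disjoint:
  assumes "a > 0" "b > 0" "a \<noteq> b"
  shows "primitive_roots_unity a \<inter> primitive_roots_unity b = {}"
proof (cases "a < b")
  case True
  with assms show ?thesis
    by (auto simp: primitive_roots_unity_def)
next
  case False
  with assms have "b < a"
    by simp
  with assms show ?thesis
    by (auto simp: primitive_roots_unity_def)
qed

lemma roots_unity_eq_Union:
  assumes "n > 0"
  shows "{z. z ^ n = 1} = (\<Union>d\<in>{d. d dvd n}. primitive_roots_unity d)"
proof (intro equalityI subsetI)
  fix z :: complex
  assume "z \<in> {z. z ^ n = 1}"
  then have z: "z ^ n = 1" by simp
  define d where "d = (LEAST d. d > 0 \<and> z ^ d = 1)"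
  have d: "d > 0 \<and> z ^ d = 1"
    unfolding d_def using assms z by (rule LeastI[of "\<lambda>d. d > 0 \<and> z ^ d = 1" n, OF conjI])
  have least: "z ^ m \<noteq> 1" if "m > 0" "m < d" for m
    using that not_less_Least[of m "\<lambda>d. d > 0 \<and> z ^ d = 1"] by (auto simp: d_def)
  have "z ^ n = (z ^ d) ^ (n div d) * z ^ (n mod d)"
    by (metis mult_div_mod_eq power_add power_mult)
  with z d have "z ^ (n mod d) = 1"
    by simp
  with least[of "n mod d"] d have "n mod d = 0"
    using mod_less_divisor[of d n] by blast
  then have "d dvd n"
    by (simp add: mod_eq_0_iff_dvd)
  with d least show "z \<in> (\<Union>d\<in>{d. d dvd n}. primitive_roots_unity d)"
    by (auto simp: primitive_roots_unity_def)
next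
  fix z :: complex
  assume "z \<in> (\<Union>d\<in>{d. d dvd n}. primitive_roots_unity d)"
  then obtain d where "d dvd n" "z ^ d = 1"
    by (auto simp: primitive_roots_unity_def)
  then have "z ^ n = 1"
    by (elim dvdE) (simp add: power_mult)
  then show "z \<in> {z. z ^ n = 1}"
    by simp
qed

lemma prod_roots_unity:
  assumes "n > 0"
  shows "(\<Prod>z\<in>{z. z ^ n = 1}. [:- z, 1:]) = (monom 1 n - 1 :: complex poly)"
proof -
  let ?S = "{z :: complex. z ^ n = 1}"
  let ?L = "\<Prod>z\<in>?S. [:- z, 1:]"
  let ?R = "monom 1 n - 1 :: complex poly"
  have fin: "finite ?S" and card: "card ?S = n"
    using assms by (simp_all add: finite_roots_unity Suc_leI card_roots_unity_eq)
  have degL: "degree ?L = n"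
    by (subst degree_prod_sum_eq) (use card in auto)
  have coL: "coeff ?L n = 1"
    using lead_coeff_prod[of "\<lambda>z. [:- z, 1:]" ?S] degL by simp
  have "degree (?L - ?R) < n \<or> ?L - ?R = 0"
  proof -
    have "coeff (?L - ?R) n = 0"
      using coL assms by simp
    moreover have "degree (?L - ?R) \<le> n"
      using degL assms by (intro degree_diff_le) (auto simp: degree_monom_le)
    ultimately show ?thesis
      using leading_coeff_0_iff[of "?L - ?R"] le_neq_implies_less[of "degree (?L - ?R)" n]
      by fastforce
  qed
  moreover have "?L - ?R = 0" if "degree (?L - ?R) < n"
  proof (rule ccontr)
    assume nz: "?L - ?R \<noteq> 0"
    have "?S \<subseteq> {z. poly (?L - ?R) z = 0}"
    proof safe
      fix z :: complex
      assume z: "z ^ n = 1"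
      have "poly ?L z = (\<Prod>w\<in>?S. z - w)"
        by (simp add: poly_prod)
      also have "\<dots> = 0"
        using fin z by (intro prod_zero) auto
      finally show "poly (?L - ?R) z = 0"
        using z by (simp add: poly_monom)
    qed
    then have "n \<le> card {z. poly (?L - ?R) z = 0}"
      using card_mono[OF poly_roots_finite[OF nz], of ?S] by (simp only: card)
    with card_poly_roots_bound[OF nz] that show False
      by linarith
  qed
  ultimately show ?thesis
    by auto
qed

lemma prod_primitive_roots_unity:
  assumes "n > 0"
  shows "(\<Prod>d\<in>{d. d dvd n}. \<Prod>z\<in>primitive_roots_unity d. [:- z, 1:]) = monom 1 n - 1"
proof -
  have pos: "d > 0" if "d dvd n" for d
    using that assms by (rule dvd_pos_nat[rotated])
  have "(\<Prod>z\<in>(\<Union>d\<in>{d. d dvd n}. primitive_roots_unity d). [:- z, 1:]) =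
        (\<Prod>d\<in>{d. d dvd n}. \<Prod>z\<in>primitive_roots_unity d. [:- z, 1:])"
    using assms pos primitive_roots_unity_disjoint
    by (intro prod.UNION_disjoint) (simp_all add: finite_primitive_roots_unity)
  with prod_roots_unity[OF assms] roots_unity_eq_Union[OF assms] show ?thesis
    by simp
qed

lemma cyclotomic_exists:
  "n > 0 \<Longrightarrow> \<exists>P. map_poly of_rat P = (\<Prod>z\<in>primitive_roots_unity n. [:- z, 1:])"
proof (induction n rule: less_induct)
  case (less n)
  define F where "F = (\<lambda>d. \<Prod>z\<in>primitive_roots_unity d. [:- z, 1:])"
  define D where "D = {d. d dvd n} - {n}"
  have "d > 0 \<and> d < n" if "d \<in> D" for d
    using that less.prems by (auto simp: D_def dest: dvd_imp_le intro: Nat.gr0I)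
  then have "\<forall>d\<in>D. \<exists>P. map_poly of_rat P = F d"
    using less.IH unfolding F_def by blast
  then obtain G where G: "\<And>d. d \<in> D \<Longrightarrow> map_poly of_rat (G d) = F d"
    by metis
  define R where "R = prod G D"
  have R: "map_poly of_rat R = prod F D"
    by (simp add: R_def map_poly_of_rat_prod G)
  have X: "map_poly of_rat (monom 1 n - 1) = (monom 1 n - 1 :: complex poly)"
    by (simp add: map_poly_of_rat_diff map_poly_monom)
  have eq: "monom 1 n - 1 = F n * prod F D"
  proof -
    have "monom 1 n - 1 = prod F {d. d dvd n}"
      using prod_primitive_roots_unity[OF less.prems] by (simp add: F_def)
    also have "\<dots> = F n * prod F D"
      unfolding D_def using less.prems by (intro prod.remove) auto
    finally show ?thesis .
  qed
  then have "(map_poly of_rat R :: complex poly) dvd map_poly of_rat (monom 1 n - 1)"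
    unfolding R X by (metis dvd_triv_right)
  then have "R dvd monom 1 n - 1"
    by (rule map_poly_of_rat_dvdD)
  then obtain P where P: "monom 1 n - 1 = R * P"
    by (elim dvdE)
  have "prod F D * map_poly of_rat P = prod F D * F n"
  proof -
    have "prod F D * map_poly of_rat P = monom 1 n - 1"
      using arg_cong[OF P, of "map_poly of_rat :: _ \<Rightarrow> complex poly"]
      by (simp only: map_poly_of_rat_mult R X)
    then show ?thesis
      by (simp only: eq mult.commute)
  qed
  moreover have "F d \<noteq> 0" if "d > 0" for d
    unfolding F_def using finite_primitive_roots_unity[OF that] by auto
  then have "prod F D \<noteq> 0"
    using \<open>\<And>d. d \<in> D \<Longrightarrow> d > 0 \<and> d < n\<close> by (cases "finite D") auto
  ultimately have "map_poly of_rat P = F n"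
    by (metis mult_left_cancel)
  then show ?case
    unfolding F_def by blast
qed

lemma map_poly_cyclotomic:
  assumes "n > 0"
  shows "map_poly of_rat (cyclotomic n) = (\<Prod>z\<in>primitive_roots_unity n. [:- z, 1:])"
proof -
  obtain P where P: "map_poly of_rat P = (\<Prod>z\<in>primitive_roots_unity n. [:- z, 1:])"
    using cyclotomic_exists[OF assms] by blast
  have "cyclotomic n = P"
    unfolding cyclotomic_def P[symmetric] map_poly_of_rat_eq_iff by simp
  with P show ?thesis
    by simp
qed

end

theory Submission
  imports Defs
begin

text \<open>
  Put $h = (n-1)/2$, $G_k(u) = \prod_{i<k} (1 - u q^{2i+1})/(u - q^{2i+2})$ and
  $S(u,v,w) = \sum_{k \le h} [4k+1] \frac{(q;q^2)_k}{(q^2;q^2)_k} q^{-2k^2-k} G_k(u) G_k(v) G_k(w)$,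
  so that the left-hand side is $S(1,1,1)$ up to terms divisible by $\Phi_n^4$.
  The substitution $k \mapsto h - k$ shows that $S(u,v,w)$ vanishes modulo $\Phi_n$ for all $u, v, w$.
  Let $u = q^{-n} = 1 + \alpha$, $v = 1 + \omega\alpha$, $w = 1 + \omega^2\alpha$ with a primitive
  cube root of unity $\omega$. The summands of $S(u,v,w)$ are then functions of $\alpha^3$, and
  $\Phi_n \mid \alpha$, so $S(1,1,1) \equiv S(u,v,w)$ modulo $\Phi_n^4$. On the other hand the choice of $u$ makes
  a limiting case of Watson's transformation applicable to $S(u,v,w)$. It yields $[n]$ times a
  sum in which, modulo $\Phi_n^3$, $\alpha^3$ may again be dropped, times a product that is
  $q^{-h}(1 - \alpha^2 \sum_{j=1}^{h} q^{2j}/(1-q^{2j})^2)$ modulo $\Phi_n^3$; the sum over $j$ is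
  $-(n^2-1)/24$ modulo $\Phi_n$. For the other divisors $d > 1$ of $n$, a Lucas-type congruence modulo
  $\Phi_d$ splits the left-hand side into blocks of length $d$, each of which vanishes by the
  reflection for $d$ in place of $n$.
\<close>

section \<open>A limiting case of Watson's transformation\<close>

text \<open>Reflection yields a single factor \<Phi>_n, so a deformation can be undone modulo
  \<Phi>_n^4 only if it first enters at third order. The cube roots of unity achieve this: a linear
  or quadratic term in \<alpha> would need its coefficient to higher precision than reflection
  gives. The coefficient of \<alpha>^3 is, up to sign, \<open>\<Sum>k\<le>h. T k * d k\<close>, an
  antisymmetric factor times a symmetric one, so reflection applies once more. Since \<omega> is
  missing from the rational functions, v and w occur only through v + w and v w, and the
  transformation is proved in these two quantities.

  The 24 arises as follows: over all nontrivial n-th roots of unity y, the terms y/(1-y)^2 sum to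
  -(n^2-1)/12, and the sum over j takes one root from each pair y, 1/y.

  The modulus is \<Phi>_n^4 times the product of the \<Phi>_d with d | n and 1 < d < n. Modulo such
  a \<Phi>_d the right-hand side vanishes because of its factor [n]. The same local argument is used
  for every divisor d > 1, which is why it lives in a locale.\<close>

text \<open>Given by the Pascal recursion rather than as a quotient, so that the values visibly lie
  in every subring containing \<open>p\<close>. The integrality of \<open>c k\<close> (see
  \<open>c_in\<close>) rests on this.\<close>

fun qbinom :: "'a::comm_ring_1 \<Rightarrow> nat \<Rightarrow> nat \<Rightarrow> 'a" where
  "qbinom p n 0 = 1"
| "qbinom p 0 (Suc k) = 0"
| "qbinom p (Suc n) (Suc k) = qbinom p n k + p ^ Suc k * qbinom p n (Suc k)"

lemma qbinom_eq_0: "n < k \<Longrightarrow> qbinom p n k = 0"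
  by (induction p n k rule: qbinom.induct) auto

lemma qpoch_0 [simp]: "qpoch x p 0 = 1"
  by (simp add: qpoch_def)

lemma qpoch_Suc [simp]: "qpoch x p (Suc k) = qpoch x p k * (1 - x * p ^ k)"
  by (simp add: qpoch_def)

lemma qpoch_add: "qpoch x p (m + k) = qpoch x p m * qpoch (x * p ^ m) p k"
  by (induction k) (simp_all add: power_add mult.assoc)

lemma qbinom_mult_qpoch:
  "k \<le> n \<Longrightarrow> qbinom p n k * (qpoch p p k * qpoch p p (n - k)) = qpoch p p n"
proof (induction n arbitrary: k)
  case 0
  then show ?case by simp
next
  case (Suc n)
  show ?case
  proof (cases k)
    case 0
    then show ?thesis by simp
  next
    case k: (Suc l)
    with Suc.prems have "l \<le> n" by simp
    have 1: "qbinom p n l * (qpoch p p k * qpoch p p (n - l)) = (1 - p ^ k) * qpoch p p n"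
      unfolding Suc.IH[OF \<open>l \<le> n\<close>, symmetric] by (simp add: k ac_simps)
    have 2: "qbinom p n k * (qpoch p p k * qpoch p p (n - l)) = (1 - p ^ (n - l)) * qpoch p p n"
    proof (cases "l = n")
      case True
      then show ?thesis by (simp add: k qbinom_eq_0)
    next
      case False
      with \<open>l \<le> n\<close> have "k \<le> n" "n - l = Suc (n - k)" by (auto simp: k)
      then show ?thesis
        by (simp add: ac_simps flip: Suc.IH[OF \<open>k \<le> n\<close>])
    qed
    have "qbinom p (Suc n) k * (qpoch p p k * qpoch p p (Suc n - k)) =
        qbinom p n l * (qpoch p p k * qpoch p p (n - l))
        + p ^ k * (qbinom p n k * (qpoch p p k * qpoch p p (n - l)))"
      by (simp add: k algebra_simps)
    also have "\<dots> = (1 - p ^ k * p ^ (n - l)) * qpoch p p n"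
      unfolding 1 2 by (simp add: algebra_simps)
    also have "p ^ k * p ^ (n - l) = p ^ Suc n"
      using \<open>l \<le> n\<close> by (simp add: k mult.assoc flip: power_add)
    finally show ?thesis by (simp add: mult.commute)
  qed
qed

lemma qpoch_nonzero:
  fixes x p :: "'a::idom"
  assumes "\<And>i. i < k \<Longrightarrow> x * p ^ i \<noteq> 1"
  shows "qpoch x p k \<noteq> 0"
  using assms by (auto simp: qpoch_def)

lemma qbinom_eq:
  fixes p :: "'a::field"
  assumes "\<And>i. i > 0 \<Longrightarrow> p ^ i \<noteq> 1" and "k \<le> n"
  shows "qbinom p n k = qpoch p p n / (qpoch p p k * qpoch p p (n - k))"
proof -
  have "qpoch p p i \<noteq> 0" for i
    using assms(1)[of "Suc _"] by (intro qpoch_nonzero) (metis power_Suc zero_less_Suc)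
  then show ?thesis
    using qbinom_mult_qpoch[OF assms(2), of p] by (simp add: eq_divide_eq)
qed

lemma qbinom_Suc_right:
  fixes p :: "'a::field"
  assumes "\<And>i. i > 0 \<Longrightarrow> p ^ i \<noteq> 1" and "k \<le> n"
  shows "(1 - p ^ Suc k) * qbinom p n (Suc k) = (1 - p ^ (n - k)) * qbinom p n k"
proof (cases "k = n")
  case True
  then show ?thesis by (simp add: qbinom_eq_0)
next
  case False
  with assms(2) obtain l where n: "n = Suc (k + l)"
    by (metis le_neq_implies_less less_imp_Suc_add)
  have nz: "1 - p * p ^ i \<noteq> 0" for i
    using assms(1)[of "Suc i"] by simp
  have "qpoch p p i \<noteq> 0" for i
    using assms(1)[of "Suc _"] by (intro qpoch_nonzero) (metis power_Suc zero_less_Suc)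
  with nz[of k] nz[of l] show ?thesis
    using assms(1) by (simp add: n qbinom_eq Suc_diff_le del: qbinom.simps)
qed

lemma qbinom_Suc_Suc:
  fixes p :: "'a::field"
  assumes "\<And>i. i > 0 \<Longrightarrow> p ^ i \<noteq> 1" and "k \<le> n"
  shows "qbinom p (Suc n) (Suc k) = p ^ (n - k) * qbinom p n k + qbinom p n (Suc k)"
  using qbinom_Suc_right[OF assms] by (simp add: algebra_simps)

text \<open>
  The $q$-Pfaff--Saalschuetz sum in the symmetric functions $s = v + w$ and $t = vw$
  of two of its parameters. The induction works because the next factor on the left is a
  combination of the next factor of either product on the right.
\<close>

lemma saalschuetz_expansion:
  fixes q s t :: "'a::field"
  assumes q: "\<And>i. i > 0 \<Longrightarrow> q ^ i \<noteq> 1"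
  defines "D \<equiv> \<lambda>i. t - q ^ (2*i+2) * s + (q ^ (2*i+2))^2"
    and "E \<equiv> \<lambda>i. 1 - q ^ (2*i+1) * s + (q ^ (2*i+1))^2 * t"
  shows "(\<Prod>i<m. D (r + i)) =
    (\<Sum>j\<le>m. q ^ j * qbinom (q^2) m j * (\<Prod>i<m-j. 1 - q ^ (4*r+2*j+2*i+3))
        * (\<Prod>i<j. E (r + i)) * (\<Prod>i<m-j. t - q ^ (2*i+1)))"
proof (induction m)
  case 0
  then show ?case by simp
next
  case (Suc m)
  define a where "a j = (\<Prod>i<j. E (r + i))" for j
  define b where "b j = (\<Prod>i<j. t - q ^ (2*i+1))" for j
  define g where "g m j = (\<Prod>i<m. 1 - q ^ (4*r+2*j+2*i+3))" for m j
  define C where "C m j = q ^ j * qbinom (q^2) m j * g (m - j) j" for m j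
  have aS: "a (Suc j) = a j * E (r + j)" and bS: "b (Suc j) = b j * (t - q ^ (2*j+1))" for j
    by (simp_all add: a_def b_def)
  have g_shift: "g (Suc m) j = (1 - q ^ (4*r+2*j+3)) * g m (Suc j)" for m j
    unfolding g_def by (subst prod.lessThan_Suc_shift) (simp add: algebra_simps)
  have g_Suc: "g (Suc m) j = g m j * (1 - q ^ (4*r+2*j+2*m+3))" for m j
    by (simp add: g_def)
  have q2: "\<And>i. i > 0 \<Longrightarrow> (q^2) ^ i \<noteq> 1"
    using q by (simp flip: power_mult)
  \<comment> \<open>The coefficient of \<open>s\<close> fixes the multiplier of
    \<open>E (r + j)\<close>; what remains then factors.\<close>
  have split: "D (r + m) = q ^ (2*(m-j)+1) * E (r + j)
      + (1 - q ^ (4*r+2*m+2*j+3)) * (t - q ^ (2*(m-j)+1))" if jm: "j \<le> m" for j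
  proof -
    obtain l where "m = j + l" using le_Suc_ex[OF jm] by blast
    define x where "x = q ^ (2*(r+j)+1)"
    define w where "w = q ^ (2*l+1)"
    have e: "q ^ (2*(r+m)+2) = x * w" "q ^ (4*r+2*m+2*j+3) = x^2 * w" "q ^ (2*(m-j)+1) = w"
      by (simp_all add: x_def w_def \<open>m = j + l\<close> algebra_simps numeral_3_eq_3 flip: power_add power_mult power_Suc)
    show ?thesis
      unfolding D_def E_def e x_def[symmetric] by (simp add: algebra_simps power2_eq_square)
  qed
  have C0: "C (Suc m) 0 = (1 - q ^ (4*r+2*m+3)) * C m 0"
    by (simp add: C_def g_Suc)
  have CS: "C (Suc m) (Suc j) = q ^ (2*(m-j)+1) * C m j
      + (if j < m then (1 - q ^ (4*r+2*m+2*Suc j+3)) * C m (Suc j) else 0)" if "j \<le> m" for j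
  proof (cases "j < m")
    case True
    then obtain l where l: "m = Suc (j + l)" by (auto dest: less_imp_Suc_add)
    have p: "qbinom (q^2) (Suc m) (Suc j)
        = (q^2) ^ (m-j) * qbinom (q^2) m j + qbinom (q^2) m (Suc j)"
      by (rule qbinom_Suc_Suc[OF q2 that])
    have p': "qbinom (q^2) (Suc m) (Suc j)
        = qbinom (q^2) m j + (q^2) ^ Suc j * qbinom (q^2) m (Suc j)"
      by simp
    define B where "B = qbinom (q^2) m j"
    define B' where "B' = qbinom (q^2) m (Suc j)"
    define Q where "Q = q ^ (4*r+2*m+3)"
    define G where "G = g l (Suc j)"
    have g1: "C m j = q ^ j * B * ((1 - q ^ (4*r+2*j+3)) * G)"
      and g2: "C m (Suc j) = q * q ^ j * B' * G"
      unfolding C_def B_def B'_def G_def by (simp_all add: l g_shift)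
    have g3: "C (Suc m) (Suc j) = q * q ^ j * qbinom (q^2) (Suc m) (Suc j) * (G * (1 - Q))"
    proof -
      have "g (Suc m - Suc j) (Suc j) = G * (1 - Q)"
        unfolding G_def Q_def by (simp add: l g_Suc add_ac)
      then show ?thesis by (simp only: C_def power_Suc)
    qed
    have e1: "q ^ (2*(m-j)+1) * q ^ (4*r+2*j+3) = q * Q"
    proof -
      have "(2*(m-j)+1) + (4*r+2*j+3) = Suc (4*r+2*m+3)"
        using that by simp
      then show ?thesis
        unfolding Q_def by (simp only: flip: power_add power_Suc)
    qed
    have e2: "q ^ (2*(m-j)+1) = q * (q^2) ^ (m-j)"
      by (simp add: power_mult)
    have e3: "q ^ (4*r+2*m+2*Suc j+3) = Q * (q^2) ^ Suc j"
    proof -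
      have "4*r+2*m+2*Suc j+3 = (4*r+2*m+3) + 2 * Suc j"
        by simp
      then show ?thesis
        unfolding Q_def by (simp only: flip: power_add power_mult)
    qed
    \<comment> \<open>Both q-Pascal rules are used at once on the product with \<open>1 - Q\<close>:
      one on the part with 1, the other on the part with \<open>Q\<close>.\<close>
    have "C (Suc m) (Suc j) = q * q ^ j * G *
        (qbinom (q^2) (Suc m) (Suc j) - Q * qbinom (q^2) (Suc m) (Suc j))"
      unfolding g3 by (simp add: algebra_simps)
    also have "\<dots> = q * q ^ j * G *
        (((q^2) ^ (m-j) * B + B') - Q * (B + (q^2) ^ Suc j * B'))"
      by (subst p, subst p') (simp only: B_def B'_def)
    also have "\<dots> = q ^ j * G * B * (q ^ (2*(m-j)+1) - q ^ (2*(m-j)+1) * q ^ (4*r+2*j+3))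
        + q * q ^ j * G * B' * (1 - Q * (q^2) ^ Suc j)"
      unfolding e1 unfolding e2 by (simp add: algebra_simps)
    finally show ?thesis
      using True unfolding e3 g1 g2 by (simp add: algebra_simps)
  next
    case False
    with that have "j = m" by simp
    then show ?thesis by (simp add: C_def qbinom_eq_0 g_def)
  qed
  have term_eq: "C m j * a j * b (m - j) * D (r + m) =
      q ^ (2*(m-j)+1) * C m j * a (Suc j) * b (m - j)
      + (1 - q ^ (4*r+2*m+2*j+3)) * C m j * a j * b (Suc m - j)" if "j \<le> m" for j
    unfolding split[OF that] using that by (simp add: aS bS Suc_diff_le algebra_simps)
  have "(\<Prod>i<Suc m. D (r + i)) = (\<Sum>j\<le>m. C m j * a j * b (m - j)) * D (r + m)"
    using Suc.IH by (simp add: C_def g_def a_def b_def)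
  also have "\<dots> = (\<Sum>j\<le>m. q ^ (2*(m-j)+1) * C m j * a (Suc j) * b (m - j))
      + (\<Sum>j\<le>m. (1 - q ^ (4*r+2*m+2*j+3)) * C m j * a j * b (Suc m - j))"
    unfolding sum_distrib_right sum.distrib[symmetric]
    by (intro sum.cong refl) (use term_eq in auto)
  also have "(\<Sum>j\<le>m. (1 - q ^ (4*r+2*m+2*j+3)) * C m j * a j * b (Suc m - j)) =
      C (Suc m) 0 * a 0 * b (Suc m)
      + (\<Sum>j<m. (1 - q ^ (4*r+2*m+2*Suc j+3)) * C m (Suc j) * a (Suc j) * b (m - j))"
    by (simp only: sum.lessThan_Suc_shift C0 flip: lessThan_Suc_atMost) simp
  also have "(\<Sum>j<m. (1 - q ^ (4*r+2*m+2*Suc j+3)) * C m (Suc j) * a (Suc j) * b (m - j)) =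
      (\<Sum>j\<le>m. (if j < m then (1 - q ^ (4*r+2*m+2*Suc j+3)) * C m (Suc j) else 0)
        * a (Suc j) * b (m - j))"
    by (simp flip: lessThan_Suc_atMost)
  also have "(\<Sum>j\<le>m. q ^ (2*(m-j)+1) * C m j * a (Suc j) * b (m - j)) +
      (C (Suc m) 0 * a 0 * b (Suc m) + \<dots>) =
      C (Suc m) 0 * a 0 * b (Suc m) + (\<Sum>j\<le>m. C (Suc m) (Suc j) * a (Suc j) * b (m - j))"
    by (simp add: CS sum.distrib distrib_right del: sum.lessThan_Suc)
  also have "\<dots> = (\<Sum>j\<le>Suc m. C (Suc m) j * a j * b (Suc m - j))"
    by (simp only: sum.atMost_Suc_shift) simp
  finally show ?case
    by (simp add: C_def g_def a_def b_def)
qed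

section \<open>The Bailey pair behind the transformation\<close>

lemma qpoch_base_square_nonzero:
  fixes q :: "'a::idom"
  assumes "\<And>i. i > 0 \<Longrightarrow> q ^ i \<noteq> 1" and "m > 0"
  shows "qpoch (q^m) (q^2) k \<noteq> 0"
proof (rule qpoch_nonzero)
  fix i
  have "q ^ m * (q^2) ^ i = q ^ (m + 2 * i)"
    by (simp only: power_add power_mult)
  with assms show "q ^ m * (q^2) ^ i \<noteq> 1"
    by simp
qed

text \<open>What the recurrence \<open>f (Suc j) r - f j r = g (Suc r) - g r\<close> of
  \<open>bailey_pair_sum\<close> becomes after division by a common factor, with
  \<open>a = q ^ (2*r)\<close> and \<open>b = q ^ (2*(j-r))\<close>.\<close>

lemma wz_certificate:
  fixes q a b :: "'a::field"
  assumes "1 - q^2 * b \<noteq> 0" and "1 - q^3 * (a^2 * b) \<noteq> 0"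
  shows "- ((1 - q * a^2) * (q^3 * a * b * (1 - q^2 * (a * b))) / ((1 - q^2 * b) * (1 - q^3 * (a^2 * b))))
      - (1 - q * a^2) =
    - ((1 - q * a) / (1 - q^3 * (a^2 * b))) - q * a * (1 - a) / (1 - q^2 * b)"
proof -
  define L where "L = 1 - q^2 * b"
  define H where "H = 1 - q^3 * (a^2 * b)"
  have nz: "L \<noteq> 0" "H \<noteq> 0"
    using assms by (simp_all add: L_def H_def)
  have "(1 - q * a^2) * (q^3 * a * b * (1 - q^2 * a * b)) + (1 - q * a^2) * (L * H)
      = (1 - q * a) * L + q * a * (1 - a) * H"
    unfolding L_def H_def by algebra
  with nz show ?thesis
    unfolding L_def[symmetric] H_def[symmetric] by (simp add: field_simps)
qed

text \<open>A Bailey pair relative to \<open>q\<close> in base \<open>q^2\<close>, a limiting case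
  of the terminating very-well-poised 6-phi-5 sum. The sum is independent of \<open>j\<close>
  because the difference of summands for \<open>j+1\<close> and \<open>j\<close> telescopes in
  \<open>r\<close>, with the WZ companion \<open>g\<close>.\<close>

lemma bailey_pair_sum:
  fixes q :: "'a::field"
  assumes q0: "q \<noteq> 0" and q: "\<And>i. i > 0 \<Longrightarrow> q ^ i \<noteq> 1"
  defines "f \<equiv> \<lambda>j r. (-1) ^ (j+r) * q ^ (j^2+2*j) / q ^ (r^2+2*r) * (1 - q ^ (4*r+1))
    * qpoch q (q^2) r * qpoch (q^2) (q^2) j
    / (qpoch (q^2) (q^2) r * qpoch (q^2) (q^2) (j-r) * qpoch (q^3) (q^2) (j+r))"
  shows "(\<Sum>r\<le>j. f j r) = 1 - q"
proof (induction j)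
  case 0
  then show ?case by (simp add: f_def)
next
  case (Suc j)
  define g where "g r = (-1) ^ (j+r) * q ^ ((j+1)^2) / q ^ (r^2) * qpoch (q^2) (q^2) j
    * qpoch q (q^2) r * (1 - (q^2) ^ r)
    / (qpoch (q^2) (q^2) r * qpoch (q^2) (q^2) (j+1-r) * qpoch (q^3) (q^2) (j+r))" for r
  have nz: "qpoch (q^2) (q^2) i \<noteq> 0" "qpoch (q^3) (q^2) i \<noteq> 0" for i
    by (rule qpoch_base_square_nonzero; use q in simp)+
  have wz: "f (Suc j) r - f j r = g (Suc r) - g r" if rj: "r \<le> j" for r
  proof -
    obtain l where j: "j = r + l" using le_Suc_ex[OF rj] by blast
    define a where "a = q ^ (2*r)"
    define b where "b = q ^ (2*l)"
    define F where "F = (-1) ^ (j+r) * q ^ (j^2+2*j) / q ^ (r^2+2*r)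
      * qpoch q (q^2) r * qpoch (q^2) (q^2) j
      / (qpoch (q^2) (q^2) r * qpoch (q^2) (q^2) l * qpoch (q^3) (q^2) (j+r))"
    have ab: "q ^ (4*r) = a^2" "q ^ (2*j) = a * b" "(q^2) ^ r = a" "(q^2) ^ l = b"
        "(q^2) ^ j = a * b" "(q^2) ^ (j+r) = a^2 * b"
      by (simp_all add: a_def b_def j power_add power_mult power2_eq_square power4_eq_xxxx algebra_simps power_mult_distrib)
    have e: "(Suc j)^2 + 2 * Suc j = (j^2+2*j) + 2*j + 3" "(j+1)^2 = (j^2+2*j)+1"
        "(Suc r)^2 = (r^2+2*r)+1"
      by (simp_all add: power2_eq_square)
    have p: "q ^ ((Suc j)^2 + 2 * Suc j) = q ^ (j^2+2*j) * (q^3 * a * b)"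
        "q ^ ((j+1)^2) = q ^ (j^2+2*j) * q" "q ^ ((Suc r)^2) = q ^ (r^2+2*r) * q"
        "q ^ (r^2+2*r) = q ^ (r^2) * a"
      unfolding e power_add[of q "j^2 + 2*j + 2*j" 3] power_add[of q "j^2 + 2*j" "2*j"] ab
      by (simp_all add: ac_simps power_add a_def)
    have p0: "q ^ (4*r+1) = q * a^2"
      by (simp add: ab)
    have jr: "j - r = l" "Suc j - r = Suc l" "j + 1 - r = Suc l" "j + 1 - Suc r = l"
      by (simp_all add: j)
    have a0: "a \<noteq> 0" using q0 by (simp add: a_def)
    have nz2: "1 - q^2 * b \<noteq> 0" "1 - q^3 * (a^2 * b) \<noteq> 0" "1 - q^2 * a \<noteq> 0"
    proof -
      have "q^2 * b = q ^ Suc (2*l+1)" "q^3 * (a^2 * b) = q ^ Suc (4*r+2*l+2)" "q^2 * a = q ^ Suc (2*r+1)"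
        by (simp_all add: a_def b_def numeral_3_eq_3 flip: power_mult power_add power_Suc)
      then show "1 - q^2 * b \<noteq> 0" "1 - q^3 * (a^2 * b) \<noteq> 0" "1 - q^2 * a \<noteq> 0"
        using q by (simp_all del: power_Suc)
    qed
    have 1: "f j r = F * (1 - q * a^2)"
      by (simp add: f_def F_def j ab)
    have 2: "f (Suc j) r = F * - ((1 - q * a^2) * (q^3 * a * b * (1 - q^2 * (a * b)))
        / ((1 - q^2 * b) * (1 - q^3 * (a^2 * b))))"
      unfolding f_def F_def jr p(1) p0 add_Suc qpoch_Suc ab
      by (simp add: ab ac_simps)
    have 3: "g r = F * (q * a * (1 - a) / (1 - q^2 * b))"
      unfolding g_def F_def jr p(2) p(4) qpoch_Suc ab using a0
      by (simp add: ab ac_simps)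
    have 4: "g (Suc r) = F * - ((1 - q * a) / (1 - q^3 * (a^2 * b)))"
      unfolding g_def F_def jr p(2,3) qpoch_Suc add_Suc_right ab using nz2 q0
      by (simp add: ab ac_simps)
    show ?thesis
      unfolding 1 2 3 4 right_diff_distrib[symmetric] by (simp only: wz_certificate[OF nz2(1,2)])
  qed
  \<comment> \<open>The top term is treated apart: truncated subtraction gives
    \<open>j - Suc j = 0\<close>, so \<open>f j (Suc j)\<close> does not vanish as the recurrence
    would require.\<close>
  have last: "f (Suc j) (Suc j) = - g (Suc j)"
  proof -
    have i: "j + Suc j = Suc (j + j)" "Suc j + Suc j = Suc (Suc (j + j))" "j + 1 - Suc j = 0"
      by simp_all
    have "q^3 * (q^2) ^ Suc (j + j) = q ^ (3 + 2 * Suc (j + j))"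
      by (simp only: power_add power_mult)
    also have "3 + 2 * Suc (j + j) = 4 * Suc j + 1"
      by simp
    finally have e: "q ^ (4 * Suc j + 1) = q^3 * (q^2) ^ Suc (j + j)" ..
    have e_nz: "1 - q^3 * (q^2) ^ Suc (j + j) \<noteq> 0"
      unfolding e[symmetric] using q[of "4 * Suc j + 1"] by simp
    have "f (Suc j) (Suc j) = qpoch q (q^2) (Suc j) / qpoch (q^3) (q^2) (Suc (j + j))"
      unfolding f_def i e qpoch_Suc[of "q^3" _ "Suc (j+j)"] using q0 nz e_nz
      by (simp del: qpoch_Suc power_Suc)
    moreover have "g (Suc j) = - (qpoch q (q^2) (Suc j) / qpoch (q^3) (q^2) (Suc (j + j)))"
    proof -
      have "1 - (q^2) ^ Suc j \<noteq> 0"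
        using q[of "2 * Suc j"] by (simp only: power_mult) simp
      moreover from this have "qpoch (q^2) (q^2) j = qpoch (q^2) (q^2) (Suc j) / (1 - (q^2) ^ Suc j)"
        by simp
      ultimately show ?thesis
        unfolding g_def i using q0 nz[of "Suc j"]
        by (simp del: qpoch_Suc power_Suc)
    qed
    ultimately show ?thesis by simp
  qed
  have "(\<Sum>r\<le>Suc j. f (Suc j) r) = (\<Sum>r\<le>j. f j r) + (\<Sum>r\<le>j. f (Suc j) r - f j r) - g (Suc j)"
    by (simp add: last sum_subtractf)
  also have "(\<Sum>r\<le>j. f (Suc j) r - f j r) = (\<Sum>r<Suc j. g (Suc r) - g r)"
    unfolding lessThan_Suc_atMost by (intro sum.cong) (auto simp: wz)
  also have "\<dots> = g (Suc j)"
    by (simp only: sum_lessThan_telescope) (simp add: g_def)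
  finally show ?case using Suc.IH by simp
qed


text \<open>The numerator factor for \<open>i = N\<close> would vanish, so this \<open>u\<close> is
  the parameter that terminates the series. Up to sign and a power of \<open>q\<close>, the product
  becomes the Bailey kernel in \<open>N - r\<close> and \<open>N + r\<close>.\<close>

lemma well_poised_factor:
  fixes q :: "'a::field" and N :: nat
  assumes q0: "q \<noteq> 0" and q: "\<And>i. i > 0 \<Longrightarrow> q ^ i \<noteq> 1" and "r \<le> N"
  defines "u \<equiv> 1 / q ^ (2*N+1)"
  shows "(\<Prod>i<r. (1 - u * q ^ (2*i+1)) / (u - q ^ (2*i+2))) =
    (-1) ^ r * q ^ (r^2) * qpoch (q^2) (q^2) N * qpoch (q^3) (q^2) N
    / (qpoch (q^2) (q^2) (N-r) * qpoch (q^3) (q^2) (N+r))"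
  using \<open>r \<le> N\<close>
proof (induction r)
  case 0
  then show ?case
    by (simp add: qpoch_base_square_nonzero q)
next
  case (Suc r)
  then obtain l where N: "N = Suc (r + l)"
    by (metis Suc_le_D Suc_le_mono le_Suc_ex)
  have e: "q ^ (2*N+1) = q ^ (2*r+1) * (q^2 * (q^2) ^ l)"
       "q ^ (2*N+1) * q ^ (2*r+2) = q^3 * (q^2) ^ (N+r)"
    by (simp_all add: N algebra_simps numeral_3_eq_3 flip: power_mult power_add power_Suc)
  have nz: "1 - q^2 * (q^2) ^ l \<noteq> 0" "1 - q^3 * (q^2) ^ (N+r) \<noteq> 0"
    using q[of "2 + 2*l"] q[of "3+2*(N+r)"] by (simp_all only: power_add power_mult) simp_all
  have "(1 - u * q ^ (2*r+1)) / (u - q ^ (2*r+2)) =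
      (q ^ (2*N+1) - q ^ (2*r+1)) / (1 - q ^ (2*N+1) * q ^ (2*r+2))"
  proof -
    define w where "w = q ^ (2*N+1)"
    have "w \<noteq> 0" using q0 by (simp add: w_def)
    then have "1 - u * x = (w - x) / w" "u - x = (1 - w * x) / w" for x
      unfolding u_def w_def[symmetric] by (simp_all add: diff_divide_distrib)
    with \<open>w \<noteq> 0\<close> show ?thesis
      by (simp add: w_def)
  qed
  also have "\<dots> = - (q ^ (2*r+1) * (1 - q^2 * (q^2) ^ l)) / (1 - q^3 * (q^2) ^ (N+r))"
    unfolding e(2) unfolding e(1) by (simp add: right_diff_distrib)
  finally have "(\<Prod>i<Suc r. (1 - u * q ^ (2*i+1)) / (u - q ^ (2*i+2))) =
    (-1) ^ r * q ^ (r^2) * qpoch (q^2) (q^2) N * qpoch (q^3) (q^2) N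
    / (qpoch (q^2) (q^2) (N-r) * qpoch (q^3) (q^2) (N+r))
     * (- (q ^ (2*r+1) * (1 - q^2 * (q^2) ^ l)) / (1 - q^3 * (q^2) ^ (N+r)))"
    using Suc by simp
  also have "N - r = Suc l" by (simp add: N)
  also have "(-1) ^ r * q ^ (r^2) * qpoch (q^2) (q^2) N * qpoch (q^3) (q^2) N
    / (qpoch (q^2) (q^2) (Suc l) * qpoch (q^3) (q^2) (N+r))
     * (- (q ^ (2*r+1) * (1 - q^2 * (q^2) ^ l)) / (1 - q^3 * (q^2) ^ (N+r))) =
    (-1) ^ Suc r * (q ^ (r^2) * q ^ (2*r+1)) * qpoch (q^2) (q^2) N * qpoch (q^3) (q^2) N
    / (qpoch (q^2) (q^2) l * qpoch (q^3) (q^2) (N + Suc r))"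
    using nz by (simp add: ac_simps)
  also have "q ^ (r^2) * q ^ (2*r+1) = q ^ ((Suc r)^2)"
    by (simp add: power2_eq_square mult_2 add_ac flip: power_add power_Suc)
  also have "l = N - Suc r" by (simp add: N)
  finally show ?case .
qed

text \<open>
  The limiting case $b, c \to 0$ of Watson's transformation of a terminating very-well-poised
  $_8\phi_7$, in base $q^2$, with $a = q$. Denominators are cleared.
\<close>

lemma watson_limit:
  fixes q s t :: "'a::field" and N :: nat
  assumes q0: "q \<noteq> 0" and q: "\<And>i. i > 0 \<Longrightarrow> q ^ i \<noteq> 1"
  defines "u \<equiv> 1 / q ^ (2*N+1)"
    and "D \<equiv> \<lambda>i. t - q ^ (2*i+2) * s + (q ^ (2*i+2))^2"
    and "E \<equiv> \<lambda>i. 1 - q ^ (2*i+1) * s + (q ^ (2*i+1))^2 * t"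
  shows "(\<Sum>r\<le>N. (1 - q ^ (4*r+1)) / (1 - q) * (qpoch q (q^2) r / qpoch (q^2) (q^2) r)
        / q ^ (2*r^2+r) * (\<Prod>i<r. (1 - u * q ^ (2*i+1)) / (u - q ^ (2*i+2)))
        * ((\<Prod>i<r. E i) * (\<Prod>i<N-r. D (r + i)))) =
    qpoch (q^3) (q^2) N * (\<Sum>j\<le>N. (-1) ^ j / q ^ (j^2+j) * qbinom (q^2) N j
        * (\<Prod>i<j. E i) * (\<Prod>i<N-j. t - q ^ (2*i+1)))"
proof -
  have q2: "\<And>i. i > 0 \<Longrightarrow> (q^2) ^ i \<noteq> 1"
    using q by (simp flip: power_mult)
  have nz: "qpoch (q^2) (q^2) i \<noteq> 0" "qpoch (q^3) (q^2) i \<noteq> 0" for i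
    by (rule qpoch_base_square_nonzero; use q in simp)+
  define A where "A r = (1 - q ^ (4*r+1)) / (1 - q) * (qpoch q (q^2) r / qpoch (q^2) (q^2) r)
        / q ^ (2*r^2+r) * (\<Prod>i<r. (1 - u * q ^ (2*i+1)) / (u - q ^ (2*i+2)))" for r
  define C where "C r l = q ^ l * qbinom (q^2) (N-r) l
    * (\<Prod>i<N-r-l. 1 - q ^ (4*r+2*l+2*i+3))" for r l
  define b where "b j = (\<Prod>i<j. E i) * (\<Prod>i<N-j. t - q ^ (2*i+1))" for j
  define f where "f j r = (-1) ^ (j+r) * q ^ (j^2+2*j) / q ^ (r^2+2*r) * (1 - q ^ (4*r+1))
    * qpoch q (q^2) r * qpoch (q^2) (q^2) j
    / (qpoch (q^2) (q^2) r * qpoch (q^2) (q^2) (j-r) * qpoch (q^3) (q^2) (j+r))" for j r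
  define K where "K j = (-1) ^ j / q ^ (j^2+j) * qpoch (q^3) (q^2) N * qbinom (q^2) N j" for j
  have E_split: "(\<Prod>i<r+l. E i) = (\<Prod>i<r. E i) * (\<Prod>i<l. E (r + i))" for r l
    by (induction l) (simp_all add: ac_simps)
  have inner: "(\<Prod>i<r. E i) * (\<Prod>i<N-r. D (r + i)) = (\<Sum>l\<le>N-r. C r l * b (r + l))" for r
  proof -
    have "(\<Prod>i<N-r. D (r + i)) = (\<Sum>l\<le>N-r. C r l * (\<Prod>i<l. E (r + i)) * (\<Prod>i<N-r-l. t - q ^ (2*i+1)))"
      unfolding D_def E_def C_def using q by (rule saalschuetz_expansion)
    then show ?thesis
      unfolding b_def E_split by (simp add: sum_distrib_left mult_ac)
  qed
  \<comment> \<open>After the tail of the \<open>D\<close> product is expanded by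
    \<open>saalschuetz_expansion\<close> and the sums are exchanged, all dependence on
    \<open>N\<close> collects in \<open>K j\<close>; the remaining sum over \<open>r\<close> is the
    one in \<open>bailey_pair_sum\<close>.\<close>
  have coeff: "A r * C r (j - r) = K j * f j r / (1 - q)" if rj: "r \<le> j" and jN: "j \<le> N" for r j
  proof -
    obtain l where j: "j = r + l" using le_Suc_ex[OF rj] by blast
    obtain m where N: "N = j + m" using le_Suc_ex[OF jN] by blast
    have "qpoch (q^3) (q^2) (N + r) = qpoch (q^3) (q^2) ((j + r) + m)"
      by (simp add: N add_ac)
    also have "\<dots> = qpoch (q^3) (q^2) (j + r) * (\<Prod>i<m. 1 - q ^ (4*r+2*l+2*i+3))"
    proof -
      have "q ^ 3 * (q^2) ^ (j + r) * (q^2) ^ i = q ^ (4*r+2*l+2*i+3)" for i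
        by (simp add: j algebra_simps flip: power_mult power_add)
      then show ?thesis
        by (simp add: qpoch_add qpoch_def[of _ _ m])
    qed
    finally have g: "(\<Prod>i<N-r-(j-r). 1 - q ^ (4*r+2*(j-r)+2*i+3)) =
        qpoch (q^3) (q^2) (N + r) / qpoch (q^3) (q^2) (j + r)"
      using nz(2)[of "j + r"] by (simp add: N j)
    have b1: "qbinom (q^2) (N - r) (j - r) =
        qpoch (q^2) (q^2) (N - r) / (qpoch (q^2) (q^2) (j - r) * qpoch (q^2) (q^2) m)"
      using qbinom_eq[OF q2, of "j - r" "N - r"] by (simp add: N j)
    have b2: "qbinom (q^2) N j =
        qpoch (q^2) (q^2) N / (qpoch (q^2) (q^2) j * qpoch (q^2) (q^2) m)"
      using qbinom_eq[OF q2, of "j" "N"] by (simp add: N)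
    have w: "(\<Prod>i<r. (1 - u * q ^ (2*i+1)) / (u - q ^ (2*i+2))) =
        (-1) ^ r * q ^ (r^2) * qpoch (q^2) (q^2) N * qpoch (q^3) (q^2) N
        / (qpoch (q^2) (q^2) (N-r) * qpoch (q^3) (q^2) (N+r))"
      unfolding u_def using q0 q order.trans[OF rj jN] by (rule well_poised_factor)
    define x where "x = q ^ (r^2)"
    define y where "y = q ^ r"
    define z where "z = q ^ l"
    define v where "v = q ^ (j^2)"
    have nz0: "x \<noteq> 0" "y \<noteq> 0" "z \<noteq> 0" "v \<noteq> 0"
      using q0 by (simp_all add: x_def y_def z_def v_def)
    have p: "q ^ (2*r^2+r) = x * x * y" "q ^ (r^2) = x" "q ^ (r^2+2*r) = x * y * y" "q ^ (j - r) = z"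
      "q ^ (j^2+j) = v * y * z" "q ^ (j^2+2*j) = v * y * z * y * z"
      by (simp_all add: x_def y_def z_def v_def j power_add mult_2 mult_2_right ac_simps)
    have sgn: "(-1) ^ j * (-1) ^ (j + r) = ((-1) ^ r :: 'a)"
      by (simp add: power_add flip: mult.assoc power_mult_distrib)
    have "K j * f j r / (1 - q) = ((-1) ^ j * (-1) ^ (j + r)) * (v * y * z * y * z / (v * y * z * (x * y * y)))
       * ((1 - q ^ (4*r+1)) / (1 - q) * (qpoch q (q^2) r / qpoch (q^2) (q^2) r)) *
       (qpoch (q^3) (q^2) N * qpoch (q^2) (q^2) N
       / (qpoch (q^2) (q^2) m * qpoch (q^2) (q^2) (j-r) * qpoch (q^3) (q^2) (j+r)))"
      unfolding K_def f_def b2 p using nz(1)[of j] by (simp add: ac_simps)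
    also have "\<dots> = A r * C r (j - r)"
      unfolding A_def C_def g b1 w p sgn using nz(1)[of "N - r"] nz(2)[of "N + r"] nz0
      by (simp add: ac_simps)
    finally show ?thesis ..
  qed
  have "(\<Sum>r\<le>N. A r * ((\<Prod>i<r. E i) * (\<Prod>i<N-r. D (r + i)))) =
      (\<Sum>r\<le>N. \<Sum>l\<le>N-r. A r * C r l * b (r + l))"
    unfolding inner by (simp add: sum_distrib_left mult.assoc)
  also have "\<dots> = (\<Sum>(r,l)\<in>{(r,l). r + l \<le> N}. A r * C r l * b (r + l))"
    by (subst sum.Sigma) (auto intro!: sum.cong)
  also have "\<dots> = (\<Sum>j\<le>N. \<Sum>r\<le>j. A r * C r (j - r) * b (r + (j - r)))"
    by (rule sum.triangle_reindex_eq)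
  also have "\<dots> = (\<Sum>j\<le>N. K j * b j)"
  proof (rule sum.cong[OF refl])
    fix j assume "j \<in> {..N}"
    then have "(\<Sum>r\<le>j. A r * C r (j - r) * b (r + (j - r))) =
        K j * b j * ((\<Sum>r\<le>j. f j r) / (1 - q))"
      unfolding sum_divide_distrib sum_distrib_left
      by (intro sum.cong refl) (simp add: coeff)
    also have "(\<Sum>r\<le>j. f j r) = 1 - q"
      unfolding f_def using q0 q by (rule bailey_pair_sum)
    finally show "(\<Sum>r\<le>j. A r * C r (j - r) * b (r + (j - r))) = K j * b j"
      using q[of 1] by simp
  qed
  finally show ?thesis
    by (simp add: A_def K_def b_def sum_distrib_left ac_simps)
qed

section \<open>Congruences modulo a cyclotomic polynomial\<close>

text \<open>
  \<^term>\<open>R\<close> plays the role of the rational functions whose denominator is coprime to the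
  cyclotomic polynomial \<^term>\<open>P\<close> of index \<^term>\<open>n\<close>, and \<open>cgr k\<close> is congruence
  modulo $P^k$ there.
\<close>

locale cyclotomic_localization =
  fixes R :: "'a::field_char_0 set" and P q :: 'a and n h :: nat
  assumes one_in [simp]: "1 \<in> R"
    and diff_in [simp]: "x \<in> R \<Longrightarrow> y \<in> R \<Longrightarrow> x - y \<in> R"
    and mult_in [simp]: "x \<in> R \<Longrightarrow> y \<in> R \<Longrightarrow> x * y \<in> R"
    and P_in [simp]: "P \<in> R"
    and q_in [simp]: "q \<in> R" and inverse_q_in: "inverse q \<in> R"
    and n_eq: "n = 2 * h + 1" and h_pos: "h > 0"
    and P_dvd: "\<exists>z\<in>R. q ^ n - 1 = P * z"
    and inverse_one_minus_in: "\<not> n dvd j \<Longrightarrow> inverse (1 - q ^ j) \<in> R"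
    and one_plus_P_nonzero: "x \<in> R \<Longrightarrow> 1 + P * x \<noteq> 0"
    and inverse_one_plus_P_in: "x \<in> R \<Longrightarrow> inverse (1 + P * x) \<in> R"
    and inverse_of_nat_in: "inverse (of_nat m) \<in> R"
    and q_nonzero: "q \<noteq> 0"
    and q_not_root: "i > 0 \<Longrightarrow> q ^ i \<noteq> 1"
begin

section \<open>Closure properties and units of the local ring\<close>

lemma zero_in [simp]: "0 \<in> R"
  using diff_in[OF one_in one_in] by simp

lemma minus_in [simp]: "x \<in> R \<Longrightarrow> - x \<in> R"
  using diff_in[OF zero_in, of x] by simp

lemma add_in [simp]: "x \<in> R \<Longrightarrow> y \<in> R \<Longrightarrow> x + y \<in> R"
  using diff_in[of x "- y"] by simp

lemma power_in [simp]: "x \<in> R \<Longrightarrow> x ^ k \<in> R"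
  by (induction k) auto

lemma sum_in: "(\<And>i. i \<in> A \<Longrightarrow> f i \<in> R) \<Longrightarrow> sum f A \<in> R"
  by (induction A rule: infinite_finite_induct) auto

lemma prod_in: "(\<And>i. i \<in> A \<Longrightarrow> f i \<in> R) \<Longrightarrow> prod f A \<in> R"
  by (induction A rule: infinite_finite_induct) auto

lemma of_nat_in [simp]: "of_nat m \<in> R"
  by (induction m) auto

lemma numeral_in [simp]: "numeral m \<in> R"
  using of_nat_in[of "numeral m"] by simp

text \<open>The condition \<open>x \<noteq> 0\<close> matters, because \<open>inverse 0 = 0\<close>
  lies in \<open>R\<close>.\<close>

definition unit :: "'a \<Rightarrow> bool"
  where "unit x \<longleftrightarrow> x \<noteq> 0 \<and> x \<in> R \<and> inverse x \<in> R"

lemma unit_in: "unit x \<Longrightarrow> x \<in> R"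
  and unit_nonzero: "unit x \<Longrightarrow> x \<noteq> 0"
  by (simp_all add: unit_def)

lemma divide_in: "x \<in> R \<Longrightarrow> unit y \<Longrightarrow> x / y \<in> R"
  by (simp add: unit_def divide_inverse)

lemma unit_1 [simp]: "unit 1"
  by (simp add: unit_def)

lemma unit_mult: "unit x \<Longrightarrow> unit y \<Longrightarrow> unit (x * y)"
  by (simp add: unit_def)

lemma unit_divide: "unit x \<Longrightarrow> unit y \<Longrightarrow> unit (x / y)"
  by (simp add: unit_def divide_inverse)

lemma unit_minus: "unit x \<Longrightarrow> unit (- x)"
  by (auto simp: unit_def nonzero_inverse_minus_eq)

lemma unit_power: "unit x \<Longrightarrow> unit (x ^ k)"
  by (induction k) (auto simp: unit_mult)

lemma unit_prod: "(\<And>i. i \<in> A \<Longrightarrow> unit (f i)) \<Longrightarrow> unit (prod f A)"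
  by (induction A rule: infinite_finite_induct) (auto simp: unit_mult)

lemma unit_q [simp]: "unit q"
  by (simp add: unit_def q_nonzero inverse_q_in)

lemma unit_q_power [simp]: "unit (q ^ k)"
  by (simp add: unit_power)

lemma unit_of_nat: "m > 0 \<Longrightarrow> unit (of_nat m)"
  by (simp add: unit_def inverse_of_nat_in)

lemma unit_numeral [simp]: "unit (numeral m)"
  using unit_of_nat[of "numeral m"] by simp

lemma unit_one_minus_q_power: "\<not> n dvd j \<Longrightarrow> unit (1 - q ^ j)"
  by (cases "j = 0") (auto simp: unit_def inverse_one_minus_in q_not_root)

lemma unit_add_P: "unit x \<Longrightarrow> y \<in> R \<Longrightarrow> unit (x + P * y)"
proof -
  assume x: "unit x" and y: "y \<in> R"
  define w where "w = y / x"
  have w: "w \<in> R" "y = x * w"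
    using divide_in[OF y x] unit_nonzero[OF x] by (simp_all add: w_def)
  from w(1) have "unit (1 + P * w)"
    by (simp add: unit_def one_plus_P_nonzero inverse_one_plus_P_in)
  with x have "unit (x * (1 + P * w))"
    by (rule unit_mult)
  then show ?thesis
    unfolding w(2) by (simp add: algebra_simps)
qed

section \<open>Calculus of congruences modulo powers of \<open>P\<close>\<close>

text \<open>Only the difference has to lie in \<open>P ^ k\<close> times \<open>R\<close>;
  membership of the two sides in \<open>R\<close> appears as a side condition where products are
  formed.\<close>

definition cgr :: "nat \<Rightarrow> 'a \<Rightarrow> 'a \<Rightarrow> bool"
  where "cgr k x y \<longleftrightarrow> (\<exists>z\<in>R. x - y = P ^ k * z)"

lemma cgrI: "x = y + P ^ k * z \<Longrightarrow> z \<in> R \<Longrightarrow> cgr k x y"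
  by (auto simp: cgr_def)

lemma cgrE:
  assumes "cgr k x y"
  obtains z where "z \<in> R" "x = y + P ^ k * z"
  using assms by (auto simp: cgr_def algebra_simps)

lemma cgr_refl [simp]: "cgr k x x"
  by (rule cgrI[of _ _ _ 0]) auto

lemma cgr_sym: "cgr k x y \<Longrightarrow> cgr k y x"
  by (erule cgrE) (rule cgrI[of _ _ _ "- _"], auto)

lemma cgr_trans [trans]:
  assumes "cgr k x y" "cgr k y z"
  shows "cgr k x z"
proof -
  obtain a b where "a \<in> R" "b \<in> R" "x = y + P ^ k * a" "y = z + P ^ k * b"
    using assms by (auto elim!: cgrE)
  then show ?thesis
    by (intro cgrI[of _ _ _ "a + b"]) (auto simp: algebra_simps)
qed

lemma eq_cgr_trans [trans]: "x = y \<Longrightarrow> cgr k y z \<Longrightarrow> cgr k x z"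
  and cgr_eq_trans [trans]: "cgr k x y \<Longrightarrow> y = z \<Longrightarrow> cgr k x z"
  by simp_all

lemma cgr_add:
  assumes "cgr k x y" "cgr k x' y'"
  shows "cgr k (x + x') (y + y')"
proof -
  obtain a b where "a \<in> R" "b \<in> R" "x = y + P ^ k * a" "x' = y' + P ^ k * b"
    using assms by (auto elim!: cgrE)
  then show ?thesis
    by (intro cgrI[of _ _ _ "a + b"]) (auto simp: algebra_simps)
qed

lemma cgr_minus: "cgr k x y \<Longrightarrow> cgr k (- x) (- y)"
  by (elim cgrE) (rule cgrI[of _ _ _ "- _"], auto simp: algebra_simps)

lemma cgr_diff: "cgr k x y \<Longrightarrow> cgr k x' y' \<Longrightarrow> cgr k (x - x') (y - y')"
  using cgr_add[OF _ cgr_minus] by simp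

lemma cgr_in: "cgr k x y \<Longrightarrow> y \<in> R \<Longrightarrow> x \<in> R"
  by (auto elim!: cgrE)

lemma cgr_mult_left: "cgr k x y \<Longrightarrow> c \<in> R \<Longrightarrow> cgr k (c * x) (c * y)"
  by (elim cgrE) (rule cgrI[of _ _ _ "c * _"], auto simp: algebra_simps)

lemma cgr_mult:
  assumes "cgr k x y" "cgr k x' y'" "x' \<in> R" "y \<in> R"
  shows "cgr k (x * x') (y * y')"
proof -
  have "cgr k (x * x') (y * x')"
    using cgr_mult_left[OF assms(1,3)] by (simp add: mult.commute)
  also have "cgr k (y * x') (y * y')"
    using assms by (intro cgr_mult_left)
  finally show ?thesis .
qed

lemma cgr_power: "cgr k x y \<Longrightarrow> y \<in> R \<Longrightarrow> cgr k (x ^ m) (y ^ m)"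
  using cgr_in by (induction m) (auto intro!: cgr_mult)

lemma cgr_sum: "(\<And>i. i \<in> A \<Longrightarrow> cgr k (f i) (g i)) \<Longrightarrow> cgr k (sum f A) (sum g A)"
  by (induction A rule: infinite_finite_induct) (auto intro: cgr_add)

lemma cgr_prod:
  assumes "\<And>i. i \<in> A \<Longrightarrow> cgr k (f i) (g i)" "\<And>i. i \<in> A \<Longrightarrow> g i \<in> R"
  shows "cgr k (prod f A) (prod g A)"
  using assms
  by (induction A rule: infinite_finite_induct) (auto intro!: cgr_mult prod_in intro: cgr_in)

lemma cgr_weaken: "cgr k x y \<Longrightarrow> m \<le> k \<Longrightarrow> cgr m x y"
proof (elim cgrE, rule cgrI)
  fix z assume "x = y + P ^ k * z" "m \<le> k" "z \<in> R"
  then show "x = y + P ^ m * (P ^ (k - m) * z)" "P ^ (k - m) * z \<in> R"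
    by (simp_all flip: power_add mult.assoc)
qed

text \<open>The means of gaining precision: a factor divisible by \<open>P ^ j\<close> allows the
  other factor to be known to \<open>j\<close> fewer powers of \<open>P\<close>.\<close>

lemma cgr_mult_zero:
  assumes "cgr j c 0" "cgr k x y"
  shows "cgr (j + k) (c * x) (c * y)"
proof -
  obtain a z where "a \<in> R" "z \<in> R" "c = P ^ j * a" "x = y + P ^ k * z"
    using assms by (auto elim!: cgrE)
  then show ?thesis
    by (intro cgrI[of _ _ _ "a * z"]) (auto simp: algebra_simps power_add)
qed

lemma cgr_mult_zero': "cgr j c 0 \<Longrightarrow> cgr k x y \<Longrightarrow> m = j + k \<Longrightarrow> cgr m (c * x) (c * y)"
  using cgr_mult_zero by simp

lemma unit_cgr:
  assumes "cgr k x y" "unit y" "k > 0"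
  shows "unit x"
proof -
  obtain z where z: "z \<in> R" "x = y + P ^ k * z"
    using assms by (auto elim!: cgrE)
  have "P ^ k = P * P ^ (k - 1)"
    using assms(3) by (simp flip: power_Suc)
  then show ?thesis
    unfolding z(2) using unit_add_P[OF assms(2), of "P ^ (k - 1) * z"] z(1)
    by (simp add: mult.assoc)
qed

lemma cgr_cancel:
  assumes "cgr k (c * x) (c * y)" and c: "unit c"
  shows "cgr k x y"
proof -
  have "cgr k (inverse c * (c * x)) (inverse c * (c * y))"
    by (rule cgr_mult_left[OF assms(1)]) (use c in \<open>simp add: unit_def\<close>)
  moreover have "inverse c * (c * z) = z" for z
    using unit_nonzero[OF c] by simp
  ultimately show ?thesis
    by simp
qed

lemma cgr_divide:
  assumes "cgr k x y" "cgr k x' y'" "unit x'" "unit y'" "y \<in> R"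
  shows "cgr k (x / x') (y / y')"
proof -
  have "cgr k (x * y') (y * x')"
    using assms by (intro cgr_mult) (auto simp: unit_in cgr_sym)
  then have "cgr k (x' * (y' * (x / x'))) (x' * (y' * (y / y')))"
    using assms(3,4)[THEN unit_nonzero] by (simp add: field_simps)
  then show ?thesis
    using assms(3,4) cgr_cancel by blast
qed

text \<open>Reversing the order of summation shows that the sum is congruent to its negative, and 2
  is a unit.\<close>

lemma cgr_zero_if_antisymmetric:
  assumes "\<And>k. k \<le> m \<Longrightarrow> cgr j (f (m - k)) (- f k)"
  shows "cgr j (\<Sum>k\<le>(m::nat). f k) 0"
proof -
  have "(\<Sum>k\<le>m. f k) = (\<Sum>k\<le>m. f (m - k))"
    by (rule sum.reindex_bij_witness[of _ "\<lambda>k. m - k" "\<lambda>k. m - k"]; simp)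
  also have "cgr j (\<Sum>k\<le>m. f (m - k)) (\<Sum>k\<le>m. - f k)"
    using assms by (intro cgr_sum) auto
  finally have "cgr j (\<Sum>k\<le>m. f k) (- (\<Sum>k\<le>m. f k))"
    unfolding sum_negf .
  then have "cgr j ((\<Sum>k\<le>m. f k) + (\<Sum>k\<le>m. f k)) (- (\<Sum>k\<le>m. f k) + (\<Sum>k\<le>m. f k))"
    by (rule cgr_add) (rule cgr_refl)
  then have "cgr j (2 * (\<Sum>k\<le>m. f k)) (2 * 0)"
    by (simp only: mult_2 left_minus add_0)
  then show ?thesis
    using unit_numeral by (rule cgr_cancel)
qed

lemma prod_one_plus_cgr:
  assumes "cgr k (c * c) 0" "c \<in> R" "\<And>i. i < m \<Longrightarrow> z i \<in> R"
  shows "cgr k (\<Prod>i<(m::nat). 1 + c * z i) (1 + c * (\<Sum>i<m. z i))"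
  using assms(3)
proof (induction m)
  case 0
  then show ?case by simp
next
  case (Suc m)
  let ?s = "\<Sum>i<m. z i"
  have s: "?s \<in> R" using Suc.prems by (auto intro: sum_in)
  have "cgr k (\<Prod>i<Suc m. 1 + c * z i) ((1 + c * ?s) * (1 + c * z m))"
    unfolding prod.lessThan_Suc using Suc assms(2) s by (intro cgr_mult) auto
  also have "(1 + c * ?s) * (1 + c * z m) = 1 + c * (?s + z m) + ?s * z m * (c * c)"
    by (simp add: algebra_simps)
  also have "cgr k \<dots> (1 + c * (?s + z m) + ?s * z m * 0)"
    using s Suc.prems by (intro cgr_add cgr_mult_left cgr_refl assms(1)) auto
  finally show ?case by simp
qed

lemma q_power_n: "cgr 1 (q ^ n) 1"
  using P_dvd by (auto simp: cgr_def)

lemma q_power_cong: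
  assumes "i + n * a = j + n * b"
  shows "cgr 1 (q ^ i) (q ^ j)"
proof -
  have 1: "cgr 1 (q ^ (i + n * a)) (q ^ i)" for i a
  proof -
    have "cgr 1 (q ^ i * (q ^ n) ^ a) (q ^ i * 1 ^ a)"
      by (intro cgr_mult_left cgr_power q_power_n) auto
    then show ?thesis by (simp add: power_add power_mult)
  qed
  have "cgr 1 (q ^ i) (q ^ (i + n * a))" by (rule cgr_sym[OF 1])
  also have "q ^ (i + n * a) = q ^ (j + n * b)" by (simp only: assms)
  also have "cgr 1 \<dots> (q ^ j)" by (rule 1)
  finally show ?thesis .
qed

subsection \<open>Reflection\<close>

definition X :: "nat \<Rightarrow> 'a" where "X i = q ^ (2*i+1)"
definition Y :: "nat \<Rightarrow> 'a" where "Y i = q ^ (2*i+2)"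

lemma unit_X [simp]: "unit (X i)" and unit_Y [simp]: "unit (Y i)"
  by (simp_all only: X_def Y_def unit_q_power)

lemma XY_in [simp]: "X i \<in> R" "Y i \<in> R"
  by (simp_all add: unit_in)

lemma not_dvd_small: "0 < j \<Longrightarrow> j < n \<Longrightarrow> \<not> n dvd j"
  by (auto dest: dvd_imp_le)

lemma unit_one_minus_X: "i < h \<Longrightarrow> unit (1 - X i)"
  unfolding X_def by (intro unit_one_minus_q_power not_dvd_small) (auto simp: n_eq)

lemma unit_one_minus_Y: "i < h \<Longrightarrow> unit (1 - Y i)"
  unfolding Y_def by (intro unit_one_minus_q_power not_dvd_small) (auto simp: n_eq)

text \<open>The exponents in \<open>X (h - 1 - i)\<close> and \<open>Y i\<close> add up to
  \<open>n\<close>. In \<open>Y_reflect\<close> the two families change roles.\<close>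

lemma X_reflect: "i < h \<Longrightarrow> cgr 1 (X (h - 1 - i)) (1 / Y i)"
proof -
  assume "i < h"
  then have "q ^ n = Y i * X (h - 1 - i)"
    unfolding X_def Y_def power_add[symmetric] by (intro arg_cong[where f = "power q"]) (simp add: n_eq)
  then have "cgr 1 (Y i * X (h - 1 - i)) (Y i * (1 / Y i))"
    using q_power_n unit_nonzero[OF unit_Y[of i]] by simp
  then show ?thesis
    by (rule cgr_cancel) simp
qed

lemma Y_reflect: "i < h \<Longrightarrow> cgr 1 (Y (h - 1 - i)) (1 / X i)"
proof -
  assume "i < h"
  then have "q ^ n = X i * Y (h - 1 - i)"
    unfolding X_def Y_def power_add[symmetric] by (intro arg_cong[where f = "power q"]) (simp add: n_eq)
  then have "cgr 1 (X i * Y (h - 1 - i)) (X i * (1 / X i))"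
    using q_power_n unit_nonzero[OF unit_X[of i]] by simp
  then show ?thesis
    by (rule cgr_cancel) simp
qed

definition c :: "nat \<Rightarrow> 'a"
  where "c k = (\<Prod>i<k. (1 - X i) / (1 - Y i))"

definition T :: "nat \<Rightarrow> 'a"
  where "T k = (1 - q ^ (4*k+1)) / (1 - q) * c k ^ 4 / q ^ (2*k^2+k)"

text \<open>The first-order response of the cubed factors to the deformation: by
  \<open>T'_cong\<close>, replacing $(1,1,1)$ by the deformed triple multiplies \<open>T k\<close>
  by \<open>1 - A * d k\<close>, modulo \<open>P ^ 4\<close>.\<close>

definition d :: "nat \<Rightarrow> 'a"
  where "d k = (\<Sum>i<k. X i ^ 3 / (1 - X i) ^ 3 + 1 / (1 - Y i) ^ 3)"

lemma unit_one_minus_q [simp]: "unit (1 - q)"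
  using unit_one_minus_q_power[of 1] h_pos by (simp add: n_eq)

lemma unit_c: "k \<le> h \<Longrightarrow> unit (c k)"
  unfolding c_def by (intro unit_prod unit_divide unit_one_minus_X unit_one_minus_Y) auto

lemma T_in: "k \<le> h \<Longrightarrow> T k \<in> R"
  unfolding T_def by (intro divide_in mult_in power_in) (auto simp: unit_in unit_c)

lemma d_in: "k \<le> h \<Longrightarrow> d k \<in> R"
  unfolding d_def
  by (intro sum_in add_in divide_in unit_power unit_one_minus_X unit_one_minus_Y) auto

text \<open>Each removed factor reflects to the next factor of \<open>c k\<close>, multiplied by
  \<open>Y k / X k = q\<close>.\<close>

lemma c_reflect: "k \<le> h \<Longrightarrow> cgr 1 (c (h - k)) (c h * (q ^ k * c k))"
proof (induction k)
  case 0
  then show ?case by (simp add: c_def)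
next
  case (Suc k)
  define i where "i = h - 1 - k"
  have k: "k < h" "i < h" "h - k = Suc i" "h - Suc k = i"
    using Suc.prems by (auto simp: i_def)
  have XY: "cgr 1 (X i) (1 / Y k)" "cgr 1 (Y i) (1 / X k)"
    using X_reflect[OF k(1)] Y_reflect[OF k(1)] by (simp_all add: i_def)
  have IH: "k \<le> h" using k(1) by simp
  note u = unit_one_minus_X[OF k(1)] unit_one_minus_Y[OF k(1)]
    unit_one_minus_X[OF k(2)] unit_one_minus_Y[OF k(2)] unit_X[of k] unit_Y[of k]
  note nz = u[THEN unit_nonzero]
  have X1: "unit (1 - 1 / X k)" and Y1: "unit (1 - 1 / Y k)"
  proof -
    have "1 - 1 / X k = - ((1 - X k) / X k)" "1 - 1 / Y k = - ((1 - Y k) / Y k)"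
      using nz by (simp_all add: field_simps)
    then show "unit (1 - 1 / X k)" "unit (1 - 1 / Y k)"
      using u by (simp_all add: unit_minus unit_divide)
  qed
  have "c i = c (h - k) * ((1 - Y i) / (1 - X i))"
    using nz by (simp add: c_def k(3))
  also have "cgr 1 \<dots> (c h * (q ^ k * c k) * ((1 - 1 / X k) / (1 - 1 / Y k)))"
    using Suc.IH[OF IH] IH u X1 Y1 unfolding k(3)
    by (intro cgr_mult cgr_divide cgr_diff cgr_refl XY divide_in mult_in diff_in)
       (auto simp: unit_in unit_c divide_in)
  also have "(1 - 1 / X k) / (1 - 1 / Y k) = (Y k / X k) * ((1 - X k) / (1 - Y k))"
  proof -
    have "1 - 1 / X k = - ((1 - X k) / X k)" "1 - 1 / Y k = - ((1 - Y k) / Y k)"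
      using nz by (simp_all add: field_simps)
    then show ?thesis by simp
  qed
  also have "Y k / X k = q"
    using q_nonzero by (simp add: X_def Y_def)
  finally show ?case
    unfolding k(4) by (simp add: c_def ac_simps)
qed

text \<open>At \<open>k = h\<close> the reflection says that \<open>c h ^ 2 * q ^ h\<close> is
  congruent to 1. Square this and compare with \<open>q ^ n = q ^ (2*h) * q\<close>.\<close>

lemma c_h_power: "cgr 1 (c h ^ 4) q"
proof -
  have "cgr 1 (c (h - h)) (c h * (q ^ h * c h))"
    by (rule c_reflect) simp
  then have "cgr 1 (c h ^ 2 * q ^ h) 1"
    by (simp add: c_def power2_eq_square ac_simps cgr_sym)
  then have "cgr 1 ((c h ^ 2 * q ^ h) ^ 2) (1 ^ 2)"
    by (rule cgr_power) simp
  moreover have "(c h ^ 2 * q ^ h) ^ 2 = q ^ (2*h) * c h ^ 4"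
    by (simp add: power_mult_distrib mult.commute flip: power_mult)
  ultimately have "cgr 1 (q ^ (2*h) * c h ^ 4) 1"
    by simp
  also have "cgr 1 1 (q ^ (2*h) * q)"
    using cgr_sym[OF q_power_n] by (simp add: n_eq mult.commute)
  finally show ?thesis
    by (rule cgr_cancel) simp
qed

text \<open>The sign comes from \<open>1 - q ^ (4*l+1)\<close>, where \<open>l = h - k\<close>,
  because \<open>4*k+1\<close> and \<open>4*l+1\<close> add up to \<open>2*n\<close>. The power
  \<open>q ^ (4*k+1)\<close> produced there cancels against the one from the fourth power of
  \<open>c\<close>, and \<open>2*l^2+l\<close> differs from \<open>2*k^2+k\<close> by
  \<open>n\<close> times the integer \<open>l - k\<close>.\<close>

lemma T_reflect: "k \<le> h \<Longrightarrow> cgr 1 (T (h - k)) (- T k)"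
proof -
  assume k: "k \<le> h"
  define l where "l = h - k"
  have h: "h = k + l" using k by (simp add: l_def)
  have n: "n = 2*k + 2*l + 1" by (simp add: n_eq h)
  note unit_q_power[THEN unit_nonzero, simp]
  have c4: "cgr 1 (c l ^ 4) (q ^ (4*k+1) * c k ^ 4)"
  proof -
    have "cgr 1 (c l ^ 4) ((c h * (q ^ k * c k)) ^ 4)"
      unfolding l_def using k by (intro cgr_power c_reflect mult_in) (auto simp: unit_in unit_c)
    also have "(c h * (q ^ k * c k)) ^ 4 = (q ^ (4*k) * c k ^ 4) * c h ^ 4"
      by (simp add: power_mult_distrib ac_simps flip: power_mult)
    also have "cgr 1 \<dots> ((q ^ (4*k) * c k ^ 4) * q)"
      using k by (intro cgr_mult_left c_h_power) (auto simp: unit_in unit_c)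
    finally show ?thesis by (simp add: ac_simps)
  qed
  have "cgr 1 (q ^ (4*k+1) * (1 - q ^ (4*l+1))) (q ^ (4*k+1) - 1)"
  proof -
    have "cgr 1 (q ^ ((4*k+1) + (4*l+1))) (q ^ 0)"
      by (rule q_power_cong[of _ 0 _ 2]) (simp add: n)
    then have "cgr 1 (q ^ (4*k+1) - q ^ (4*k+1) * q ^ (4*l+1)) (q ^ (4*k+1) - 1)"
      unfolding power_add[symmetric] by (intro cgr_diff) auto
    then show ?thesis by (simp add: right_diff_distrib)
  qed
  then have "cgr 1 (c l ^ 4 * (q ^ (4*k+1) * (1 - q ^ (4*l+1))))
      (q ^ (4*k+1) * c k ^ 4 * (q ^ (4*k+1) - 1))"
    using c4 k by (intro cgr_mult) (auto simp: unit_in unit_c)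
  then have "cgr 1 (q ^ (4*k+1) * (c l ^ 4 * (1 - q ^ (4*l+1))))
      (q ^ (4*k+1) * (c k ^ 4 * (q ^ (4*k+1) - 1)))"
    by (simp only: ac_simps)
  then have "cgr 1 (c l ^ 4 * (1 - q ^ (4*l+1))) (c k ^ 4 * (q ^ (4*k+1) - 1))"
    by (rule cgr_cancel) (rule unit_q_power)
  moreover have "cgr 1 (q ^ (2*l^2+l)) (q ^ (2*k^2+k))"
    by (rule q_power_cong[of _ k _ l]) (simp add: n algebra_simps power2_eq_square)
  ultimately have "cgr 1 (c l ^ 4 * (1 - q ^ (4*l+1)) / ((1 - q) * q ^ (2*l^2+l)))
     (c k ^ 4 * (q ^ (4*k+1) - 1) / ((1 - q) * q ^ (2*k^2+k)))"
    using k by (intro cgr_divide cgr_mult_left unit_mult) (auto simp: unit_in unit_c)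
  moreover have "c l ^ 4 * (1 - q ^ (4*l+1)) / ((1 - q) * q ^ (2*l^2+l)) = T l"
    by (simp add: T_def ac_simps)
  moreover have "c k ^ 4 * (q ^ (4*k+1) - 1) / ((1 - q) * q ^ (2*k^2+k)) = - T k"
  proof -
    have e: "q ^ (4*k+1) - 1 = - (1 - q ^ (4*k+1))" by simp
    show ?thesis unfolding e T_def by (simp add: ac_simps del: minus_diff_eq)
  qed
  ultimately show ?thesis
    by (simp only: l_def)
qed

text \<open>Under x to 1/x the expressions x^3/(1-x)^3 and -1/(1-x)^3 are exchanged, so reflection
  turns each summand of \<open>d\<close> into the negative of its partner.\<close>

lemma d_reflect: "k \<le> h \<Longrightarrow> cgr 1 (d (h - k)) (d h + d k)"
proof (induction k)
  case 0
  then show ?case by (simp add: d_def)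
next
  case (Suc k)
  define i where "i = h - 1 - k"
  have k: "k < h" "i < h" "h - k = Suc i" "h - Suc k = i"
    using Suc.prems by (auto simp: i_def)
  have XY: "cgr 1 (X i) (1 / Y k)" "cgr 1 (Y i) (1 / X k)"
    using X_reflect[OF k(1)] Y_reflect[OF k(1)] by (simp_all add: i_def)
  have IH: "k \<le> h" using k(1) by simp
  note u = unit_one_minus_X[OF k(1)] unit_one_minus_Y[OF k(1)]
    unit_one_minus_X[OF k(2)] unit_one_minus_Y[OF k(2)] unit_X[of k] unit_Y[of k]
  note nz = u[THEN unit_nonzero]
  have e: "1 - 1 / X k = - ((1 - X k) / X k)" "1 - 1 / Y k = - ((1 - Y k) / Y k)"
      using nz by (simp_all add: field_simps)
  then have X1: "unit (1 - 1 / X k)" and Y1: "unit (1 - 1 / Y k)"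
    using u by (simp_all add: unit_minus unit_divide)
  have 1: "(1 / Y k) ^ 3 / (1 - 1 / Y k) ^ 3 = - (1 / (1 - Y k) ^ 3)"
    and 2: "1 / (1 - 1 / X k) ^ 3 = - (X k ^ 3 / (1 - X k) ^ 3)"
    unfolding e using nz by (simp_all add: power_divide power_minus_odd)
  have "d i = d (h - k) - (X i ^ 3 / (1 - X i) ^ 3 + 1 / (1 - Y i) ^ 3)"
    by (simp add: d_def k(3))
  also have "cgr 1 \<dots> (d h + d k - ((1 / Y k) ^ 3 / (1 - 1 / Y k) ^ 3 + 1 / (1 - 1 / X k) ^ 3))"
    using Suc.IH[OF IH] IH u X1 Y1 unfolding k(3)
    by (intro cgr_diff cgr_add cgr_divide cgr_power cgr_refl XY unit_power diff_in
        divide_in power_in) (auto simp: unit_in divide_in)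
  also have "\<dots> = d h + d (Suc k)"
    unfolding 1 2 by (simp add: d_def)
  finally show ?case
    unfolding k(4) .
qed

lemma sum_T: "cgr 1 (\<Sum>k\<le>h. T k) 0"
  by (intro cgr_zero_if_antisymmetric T_reflect)

lemma sum_T_d: "cgr 1 (\<Sum>k\<le>h. T k * d k) 0"
proof (rule cgr_zero_if_antisymmetric)
  fix k assume k: "k \<le> h"
  \<comment> \<open>The case \<open>k = h\<close> forces \<open>d h\<close> to vanish, which makes
    \<open>d\<close> symmetric, whereas \<open>T\<close> is antisymmetric.\<close>
  have "cgr 1 (d (h - h)) (d h + d h)"
    by (rule d_reflect) simp
  then have "cgr 1 (2 * d h) (2 * 0)"
    by (simp only: diff_self_eq_0 d_def lessThan_0 sum.empty mult_2 add_0 cgr_sym)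
  then have dh: "cgr 1 (d h) 0"
    by (rule cgr_cancel) simp
  have "cgr 1 (d (h - k)) (d h + d k)"
    by (rule d_reflect[OF k])
  also have "cgr 1 \<dots> (0 + d k)"
    by (intro cgr_add dh cgr_refl)
  finally have "cgr 1 (d (h - k)) (d k)"
    by simp
  then have "cgr 1 (T (h - k) * d (h - k)) (- T k * d k)"
    using k by (intro cgr_mult T_reflect d_in minus_in T_in) auto
  then show "cgr 1 (T (h - k) * d (h - k)) (- (T k * d k))"
    by simp
qed

end

section \<open>Sums over roots of unity\<close>

text \<open>Used with \<open>m = N = n\<close> and \<open>y ^ n\<close> congruent to 1, where the
  right-hand side collapses to 2 n y (1-y).\<close>

lemma sum_quadratic_times_power:
  fixes y m :: "'a::comm_ring_1"
  shows "(1 - y) ^ 3 * (\<Sum>k<N. of_nat k * (m - of_nat k) * y ^ k) =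
    y ^ N * ((1 - y)^2 * of_nat N ^ 2 + (2 * y * (1 - y) - m * (1 - y)^2) * of_nat N
      + y * (1 + y - m * (1 - y))) - y * (1 + y - m * (1 - y))"
proof (induction N)
  case 0
  then show ?case by simp
next
  case (Suc N)
  then show ?case
    by (simp add: distrib_left) (simp add: algebra_simps power2_eq_square power3_eq_cube)
qed

lemma sum_quadratic: "6 * (\<Sum>k<N. of_nat k * (m - of_nat k)) =
    (of_nat N * (of_nat N - 1) * (3 * m - 2 * of_nat N + 1) :: 'a::comm_ring_1)"
  by (induction N) (simp_all add: algebra_simps)

context cyclotomic_localization
begin

lemma q_power_1: "n dvd i \<Longrightarrow> cgr 1 (q ^ i) 1"
  using q_power_cong[of i 0 0] by (auto elim!: dvdE)

lemma not_dvd_Y: "i < 2 * h \<Longrightarrow> \<not> n dvd 2 * i + 2"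
proof
  assume i: "i < 2 * h" and "n dvd 2 * i + 2"
  moreover have "coprime n 2" by (simp add: n_eq)
  moreover have "2 * i + 2 = 2 * (i + 1)" by simp
  ultimately have "n dvd i + 1" by (metis coprime_dvd_mult_right_iff)
  then show False
    using i not_dvd_small[of "i + 1"] by (simp add: n_eq)
qed

lemma unit_one_minus_Y': "i < 2 * h \<Longrightarrow> unit (1 - Y i)"
  unfolding Y_def by (intro unit_one_minus_q_power not_dvd_Y)

text \<open>A quotient at a nontrivial root of unity is traded for a polynomial in that root, so
  that summing over the roots only involves power sums.\<close>

lemma quotient_eq_sum:
  assumes "i < 2 * h"
  shows "cgr 1 (\<Sum>k<n. of_nat k * (of_nat n - of_nat k) * Y i ^ k)
    (2 * of_nat n * (Y i / (1 - Y i)^2))" (is "cgr 1 ?S _")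
proof -
  let ?y = "Y i"
  note u = unit_one_minus_Y'[OF assms]
  let ?g = "(1 - ?y)^2 * of_nat n ^ 2 + (2 * ?y * (1 - ?y) - of_nat n * (1 - ?y)^2) * of_nat n
      + ?y * (1 + ?y - of_nat n * (1 - ?y))"
  have yn: "cgr 1 (?y ^ n) 1"
    unfolding Y_def power_mult[symmetric] by (rule q_power_1) simp
  have "(1 - ?y) ^ 3 * ?S = ?y ^ n * ?g - ?y * (1 + ?y - of_nat n * (1 - ?y))"
    by (rule sum_quadratic_times_power)
  also have "cgr 1 \<dots> (1 * ?g - ?y * (1 + ?y - of_nat n * (1 - ?y)))"
    by (intro cgr_diff cgr_mult yn cgr_refl) auto
  also have "\<dots> = (1 - ?y) ^ 3 * (2 * of_nat n * (?y / (1 - ?y)^2))"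
    using unit_nonzero[OF u] by (simp add: power3_eq_cube power2_eq_square) (simp add: algebra_simps)
  finally show ?thesis
    by (rule cgr_cancel) (intro unit_power u)
qed

text \<open>The full geometric sum over \<open>i < n\<close> vanishes since \<open>n\<close> is odd
  and does not divide \<open>2 * k\<close>; the range here omits its term 1.\<close>

lemma sum_Y_power:
  assumes "0 < k" "k < n"
  shows "cgr 1 (\<Sum>i<2*h. Y i ^ k) (- 1)"
proof -
  let ?z = "q ^ (2 * k)"
  have "\<not> n dvd 2 * k"
  proof
    assume "n dvd 2 * k"
    moreover have "coprime n 2" by (simp add: n_eq)
    ultimately have "n dvd k" by (metis coprime_dvd_mult_right_iff)
    then show False using not_dvd_small assms by blast
  qed
  then have u: "unit (1 - ?z)"
    by (rule unit_one_minus_q_power)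
  have "(1 - ?z) * (\<Sum>i<n. ?z ^ i) = 1 - ?z ^ n"
    by (rule one_diff_power_eq[symmetric])
  also have "cgr 1 \<dots> (1 - 1)"
    unfolding power_mult[symmetric] by (intro cgr_diff q_power_1) simp_all
  finally have "cgr 1 ((1 - ?z) * (\<Sum>i<n. ?z ^ i)) ((1 - ?z) * 0)"
    by simp
  then have "cgr 1 (\<Sum>i<n. ?z ^ i) 0"
    using u by (rule cgr_cancel)
  then have "cgr 1 ((\<Sum>i<n. ?z ^ i) - 1) (0 - 1)"
    by (intro cgr_diff cgr_refl)
  moreover have "(\<Sum>i<n. ?z ^ i) = 1 + (\<Sum>i<2*h. Y i ^ k)"
  proof -
    have "?z ^ Suc i = Y i ^ k" for i
      unfolding Y_def power_mult[symmetric] by (rule arg_cong[where f = "power q"]) simp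
    then show ?thesis
      by (simp only: n_eq add_Suc_right flip: Suc_eq_plus1)
        (simp only: sum.lessThan_Suc_shift power_0)
  qed
  ultimately show ?thesis by simp
qed

text \<open>The map y to 1/y fixes y/(1-y)^2 and pairs the indices below \<open>h\<close> with those
  from \<open>h\<close> to \<open>2*h - 1\<close>. The sum over all of these follows from power sums
  and the value n(n^2-1)/6 of the sum of k(n-k).\<close>

lemma sum_quotient:
  "cgr 1 (\<Sum>i<h. Y i / (1 - Y i)^2) (- ((of_nat n ^ 2 - 1) / 24))"
proof -
  define f where "f i = Y i / (1 - Y i)^2" for i
  have refl: "cgr 1 (f (h + (h - Suc i))) (f i)" if i: "i < h" for i
  proof -
    define j where "j = h + (h - Suc i)"
    have j: "j < 2 * h" "2 * j + 2 + (2 * i + 2) = 2 * n"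
      using i by (auto simp: j_def n_eq)
    note u = unit_one_minus_Y'[OF j(1)] unit_one_minus_Y[OF i] unit_Y[of i]
    note nz = u[THEN unit_nonzero]
    have "cgr 1 (Y i * Y j) (Y i * (1 / Y i))"
      proof -
      have "Y i * Y j = q ^ (2 * j + 2 + (2 * i + 2))"
        unfolding Y_def power_add[symmetric] by (simp add: add_ac)
      then show ?thesis
        using q_power_1[of "2 * j + 2 + (2 * i + 2)"] nz(3) j(2) by simp
    qed
    then have Yj: "cgr 1 (Y j) (1 / Y i)"
      by (rule cgr_cancel) simp
    have e: "1 - 1 / Y i = - ((1 - Y i) / Y i)"
      using nz by (simp add: field_simps)
    have "cgr 1 (f j) ((1 / Y i) / (1 - 1 / Y i)^2)"
      unfolding f_def using u
      by (intro cgr_divide cgr_power cgr_diff Yj cgr_refl unit_power diff_in divide_in)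
        (auto simp: e unit_minus unit_divide)
    also have "\<dots> = f i"
      unfolding e f_def using nz by (simp add: power2_eq_square)
    finally show ?thesis by (simp only: j_def)
  qed
  have split: "(\<Sum>i<m+h. f i) = (\<Sum>i<m. f i) + (\<Sum>i<h. f (m + i))" for m h
    by (induction h) auto
  have "cgr 1 (\<Sum>i<2*h. f i) ((\<Sum>i<h. f i) + (\<Sum>i<h. f i))"
    unfolding mult_2 split sum.nat_diff_reindex[of "\<lambda>i. f (h + i)" h, symmetric]
    by (intro cgr_add cgr_refl cgr_sum refl) auto
  then have "cgr 1 ((2 * of_nat n) * (\<Sum>i<2*h. f i)) ((2 * of_nat n) * (2 * (\<Sum>i<h. f i)))"
    unfolding mult_2[of "sum f _"] by (intro cgr_mult_left) auto
  from cgr_sym[OF this]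
  have "cgr 1 ((2 * of_nat n) * (2 * (\<Sum>i<h. f i))) (\<Sum>i<2*h. 2 * of_nat n * f i)"
    by (simp only: sum_distrib_left)
  also have "cgr 1 \<dots> (\<Sum>i<2*h. \<Sum>k<n. of_nat k * (of_nat n - of_nat k) * Y i ^ k)"
    unfolding f_def by (intro cgr_sum cgr_sym[OF quotient_eq_sum]) auto
  also have "\<dots> = (\<Sum>k<n. of_nat k * (of_nat n - of_nat k) * (\<Sum>i<2*h. Y i ^ k))"
    by (subst sum.swap) (simp add: sum_distrib_left)
  also have "cgr 1 \<dots> (\<Sum>k<n. of_nat k * (of_nat n - of_nat k) * - 1)"
  proof (intro cgr_sum)
    fix k assume k: "k \<in> {..<n}"
    show "cgr 1 (of_nat k * (of_nat n - of_nat k) * (\<Sum>i<2*h. Y i ^ k))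
        (of_nat k * (of_nat n - of_nat k) * - 1)"
    proof (cases "k = 0")
      case False
      with k show ?thesis by (intro cgr_mult_left sum_Y_power) auto
    qed simp
  qed
  also have "\<dots> = - (6 * (\<Sum>k<n. of_nat k * (of_nat n - of_nat k)) / 6)"
    by (simp add: sum_negf)
  also have "\<dots> = (2 * of_nat n) * (2 * - ((of_nat n ^ 2 - 1) / 24))"
    unfolding sum_quadratic by (simp add: field_simps power2_eq_square)
  finally show ?thesis
    unfolding f_def
    by (rule cgr_cancel[OF cgr_cancel])
      (use h_pos in \<open>simp_all add: unit_mult unit_of_nat n_eq del: of_nat_add of_nat_mult of_nat_Suc\<close>)
qed

subsection \<open>The congruence modulo the fourth power\<close>

definition \<alpha> :: 'a where "\<alpha> = 1 / q ^ n - 1"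
definition A :: 'a where "A = \<alpha> ^ 3"

lemma \<alpha>_0: "cgr 1 \<alpha> 0"
proof -
  have "cgr 1 (1 / q ^ n) (1 / 1)"
    by (intro cgr_divide q_power_n cgr_refl) auto
  then have "cgr 1 (1 / q ^ n - 1) (1 / 1 - 1)"
    by (intro cgr_diff cgr_refl)
  then show ?thesis by (simp add: \<alpha>_def)
qed

lemma \<alpha>_in [simp]: "\<alpha> \<in> R"
  using cgr_in[OF \<alpha>_0] by simp

lemma A_in [simp]: "A \<in> R"
  by (simp add: A_def)

lemma \<alpha>2_0: "cgr 2 (\<alpha> ^ 2) 0"
  using cgr_mult_zero[OF \<alpha>_0 \<alpha>_0] by (simp add: power2_eq_square numeral_2_eq_2)

lemma A_0: "cgr 3 A 0"
  using cgr_mult_zero[OF \<alpha>_0 \<alpha>2_0]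
  by (simp add: A_def power2_eq_square power3_eq_cube numeral_3_eq_3 mult.assoc)

text \<open>
  The deformation \<open>T'\<close> of \<^const>\<open>T\<close> replaces $(1,1,1)$ by
  $(1+\alpha, 1+\omega\alpha, 1+\omega^2\alpha)$, where $\omega$ is a primitive cube root of unity.
  Everything symmetric in the last two entries depends only on their sum $2 - \alpha$ and
  their product $1 - \alpha + \alpha^2$. As the first two elementary symmetric functions of
  $\alpha, \omega\alpha, \omega^2\alpha$ vanish, only $\alpha^3$ enters.
\<close>

definition T' :: "nat \<Rightarrow> 'a"
  where "T' k = (1 - q ^ (4*k+1)) / (1 - q) * c k / q ^ (2*k^2+k)
    * (\<Prod>i<k. ((1 - X i) ^ 3 - X i ^ 3 * A) / ((1 - Y i) ^ 3 + A))"

lemma unit_perturbed: "i < h \<Longrightarrow> unit ((1 - Y i) ^ 3 + A)"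
proof -
  assume i: "i < h"
  have "cgr 3 ((1 - Y i) ^ 3 + A) ((1 - Y i) ^ 3 + 0)"
    by (intro cgr_add cgr_refl A_0)
  then show ?thesis
    by (rule unit_cgr) (use i in \<open>simp_all add: unit_power unit_one_minus_Y\<close>)
qed

text \<open>As \<open>A\<close> is divisible by \<open>P ^ 3\<close>, only the part linear in
  \<open>A\<close> survives modulo \<open>P ^ 4\<close>, and its coefficient matters only modulo
  \<open>P\<close>.\<close>

lemma T'_cong:
  assumes "k \<le> h"
  shows "cgr 4 (T' k) (T k * (1 - A * d k))"
proof -
  define x where "x i = X i ^ 3 / (1 - X i) ^ 3" for i
  define y where "y i = 1 / (1 - Y i) ^ 3" for i
  define z where "z i = - ((x i + y i) / (1 + y i * A))" for i
  have xy: "x i \<in> R" "y i \<in> R" if "i < k" for i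
    unfolding x_def y_def using that assms
    by (auto intro!: divide_in unit_power unit_one_minus_X unit_one_minus_Y)
  have cg1: "cgr 3 (1 + y i * A) (1 + y i * 0)" if "i < k" for i
    using xy[OF that] by (intro cgr_add cgr_mult_left A_0 cgr_refl)
  have u1: "unit (1 + y i * A)" if "i < k" for i
    by (rule unit_cgr[OF cg1[OF that]]) auto
  have z_in: "z i \<in> R" if "i < k" for i
    unfolding z_def using that xy u1 by (intro minus_in divide_in add_in) auto
  have z: "cgr 1 (z i) (- (x i + y i))" if "i < k" for i
  proof -
    have "cgr 1 (1 + y i * A) (1 + y i * 0)"
      by (rule cgr_weaken[OF cg1[OF that]]) simp
    then have "cgr 1 ((x i + y i) / (1 + y i * A)) ((x i + y i) / 1)"
      using u1 xy that by (intro cgr_divide cgr_refl) auto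
    then show ?thesis
      unfolding z_def using cgr_minus by fastforce
  qed
  have factor: "((1 - X i) ^ 3 - X i ^ 3 * A) / ((1 - Y i) ^ 3 + A) =
      ((1 - X i) / (1 - Y i)) ^ 3 * (1 + A * z i)" if "i < k" for i
  proof -
    have "i < h" using that assms by simp
    note u = unit_one_minus_X[OF this] unit_one_minus_Y[OF this] u1[OF that]
    note nz = u[THEN unit_nonzero]
    have "1 + A * z i = (1 - x i * A) / (1 + y i * A)"
      using nz(3) by (simp add: z_def field_simps)
    moreover have "(1 - X i) ^ 3 - X i ^ 3 * A = (1 - X i) ^ 3 * (1 - x i * A)"
      using nz(1) by (simp add: x_def right_diff_distrib)
    moreover have "(1 - Y i) ^ 3 + A = (1 - Y i) ^ 3 * (1 + y i * A)"
      using nz(2) by (simp add: y_def distrib_left)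
    ultimately show ?thesis
      by (simp add: power_divide)
  qed
  have "(\<Prod>i<k. ((1 - X i) ^ 3 - X i ^ 3 * A) / ((1 - Y i) ^ 3 + A)) =
      c k ^ 3 * (\<Prod>i<k. 1 + A * z i)"
    unfolding c_def prod_power_distrib prod.distrib[symmetric]
    by (intro prod.cong refl) (use factor in auto)
  then have e: "T' k = T k * (\<Prod>i<k. 1 + A * z i)"
    by (simp add: T'_def T_def power4_eq_xxxx power3_eq_cube)
  have AA: "cgr 4 (A * A) 0"
    by (rule cgr_weaken[of 6]) (use cgr_mult_zero[OF A_0 A_0] in auto)
  have "cgr 4 (\<Prod>i<k. 1 + A * z i) (1 + A * (\<Sum>i<k. z i))"
    by (intro prod_one_plus_cgr AA z_in) auto
  also have "cgr 4 \<dots> (1 + A * (\<Sum>i<k. - (x i + y i)))"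
  proof -
    have "cgr (3 + 1) (A * (\<Sum>i<k. z i)) (A * (\<Sum>i<k. - (x i + y i)))"
      by (intro cgr_mult_zero A_0 cgr_sum z) auto
    then show ?thesis by (intro cgr_add cgr_refl) simp
  qed
  also have "(\<Sum>i<k. - (x i + y i)) = - d k"
    by (simp only: sum_negf d_def x_def y_def)
  finally have "cgr 4 (\<Prod>i<k. 1 + A * z i) (1 - A * d k)"
    by simp
  then show ?thesis
    unfolding e by (rule cgr_mult_left) (rule T_in[OF assms])
qed

text \<open>The linear term carries \<open>P ^ 3\<close> from \<open>A\<close> and the fourth power
  of \<open>P\<close> from \<open>sum_T_d\<close>.\<close>

lemma sum_T': "cgr 4 (\<Sum>k\<le>h. T k) (\<Sum>k\<le>h. T' k)"
proof -
  have "cgr 4 (\<Sum>k\<le>h. T' k) (\<Sum>k\<le>h. T k * (1 - A * d k))"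
    by (intro cgr_sum T'_cong) auto
  also have "\<dots> = (\<Sum>k\<le>h. T k) - A * (\<Sum>k\<le>h. T k * d k)"
    by (simp add: algebra_simps sum_subtractf sum_distrib_left)
  also have "cgr 4 \<dots> ((\<Sum>k\<le>h. T k) - A * 0)"
    using cgr_mult_zero[OF A_0 sum_T_d] by (intro cgr_diff cgr_refl) simp
  finally show ?thesis
    by (simp add: cgr_sym)
qed

section \<open>Evaluation of the deformed sum by Watson's transformation\<close>

definition u :: 'a where "u = 1 / q ^ n"
definition t :: 'a where "t = 1 - \<alpha> + \<alpha>^2"
text \<open>With v + w = 2 - \<alpha> and v w = \<open>t\<close>, \<open>D i\<close> is (v -
  \<open>Y i\<close>)(w - \<open>Y i\<close>) and \<open>E i\<close> is (1 - v \<open>X i\<close>)(1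
  - w \<open>X i\<close>).\<close>

definition D :: "nat \<Rightarrow> 'a" where "D i = t - Y i * (2 - \<alpha>) + (Y i)^2"
definition E :: "nat \<Rightarrow> 'a" where "E i = 1 - X i * (2 - \<alpha>) + (X i)^2 * t"

lemma u_eq: "u = 1 + \<alpha>" and u_nonzero: "u \<noteq> 0" and unit_u [simp]: "unit u"
  by (simp_all add: u_def \<alpha>_def q_nonzero unit_divide)

lemma u_in [simp]: "u \<in> R" and t_in [simp]: "t \<in> R"
  by (simp_all add: unit_in t_def)

lemma ut_eq: "u * t = 1 + A"
  by (simp add: u_eq t_def A_def algebra_simps power2_eq_square power3_eq_cube)

text \<open>The factorization of a difference of two cubes over the cube roots of unity;
  \<open>D_eq\<close> is the one for a sum.\<close>

lemma E_eq: "(1 - u * X i) * E i = (1 - X i) ^ 3 - X i ^ 3 * A"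
  unfolding u_eq t_def A_def E_def by algebra

lemma D_eq: "(u - Y i) * D i = (1 - Y i) ^ 3 + A"
  unfolding u_eq t_def A_def D_def by algebra

lemma unit_u_minus_Y: "i < h \<Longrightarrow> unit (u - Y i)"
proof -
  assume i: "i < h"
  have "cgr 1 (1 + \<alpha> - Y i) (1 + 0 - Y i)"
    by (intro cgr_add cgr_diff \<alpha>_0 cgr_refl)
  then show ?thesis
    unfolding u_eq by (rule unit_cgr) (use i in \<open>simp_all add: unit_one_minus_Y\<close>)
qed

lemma D_eq': "i < h \<Longrightarrow> D i = ((1 - Y i) ^ 3 + A) / (u - Y i)"
  using D_eq[of i] unit_nonzero[OF unit_u_minus_Y, of i] by (simp add: eq_divide_eq mult.commute)

lemma unit_D: "i < h \<Longrightarrow> unit (D i)"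
  by (simp add: D_eq' unit_divide unit_perturbed unit_u_minus_Y)

text \<open>Exact counterpart of \<open>X_reflect\<close>: \<open>q ^ n\<close> is kept as
  \<open>1 / u\<close>, because the evaluation needs more precision than one power of
  \<open>P\<close>.\<close>

lemma X_reflect_eq: "i < h \<Longrightarrow> X (h - Suc i) = 1 / (u * Y i)"
proof -
  assume "i < h"
  then have "X (h - Suc i) * Y i = q ^ n"
    unfolding X_def Y_def power_add[symmetric] by (intro arg_cong[where f = "power q"]) (simp add: n_eq)
  then show ?thesis
    using unit_nonzero[OF unit_Y[of i]] q_nonzero by (simp add: u_def field_simps)
qed

definition B :: "nat \<Rightarrow> 'a"
  where "B j = (-1) ^ j / q ^ (j^2+j) * qbinom (q^2) h j * (\<Prod>i<j. E i) * (\<Prod>i<h-j. t - X i)"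

definition b :: "nat \<Rightarrow> 'a"
  where "b j = (-1) ^ j / q ^ (j^2) * ((\<Prod>i<j. 1 - X i) ^ 3 / (\<Prod>i<j. 1 - Y i) ^ 2)"

lemma prod_eq_qpoch:
  "(\<Prod>i<k. 1 - X i) = qpoch q (q^2) k" "(\<Prod>i<k. 1 - Y i) = qpoch (q^2) (q^2) k"
proof -
  have "q * (q^2) ^ i = X i" "q^2 * (q^2) ^ i = Y i" for i
    unfolding X_def Y_def power_add power_mult by (simp_all add: mult.commute)
  then show "(\<Prod>i<k. 1 - X i) = qpoch q (q^2) k" "(\<Prod>i<k. 1 - Y i) = qpoch (q^2) (q^2) k"
    by (simp_all add: qpoch_def)
qed

lemma c_eq_qpoch: "c k = qpoch q (q^2) k / qpoch (q^2) (q^2) k"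
  by (simp add: c_def prod_dividef prod_eq_qpoch)

lemma sum_T'_eq: "(\<Sum>k\<le>h. T' k) * (\<Prod>i<h. D i) = qpoch (q^3) (q^2) h * (\<Sum>j\<le>h. B j)"
proof -
  have "T' k * (\<Prod>i<h. D i) = (1 - q ^ (4*k+1)) / (1 - q) * (qpoch q (q^2) k / qpoch (q^2) (q^2) k)
        / q ^ (2*k^2+k) * (\<Prod>i<k. (1 - u * X i) / (u - Y i))
        * ((\<Prod>i<k. E i) * (\<Prod>i<h-k. D (k + i)))" if k: "k \<le> h" for k
  proof -
    have split: "(\<Prod>i<k+m. D i) = (\<Prod>i<k. D i) * (\<Prod>i<m. D (k + i))" for m
      by (induction m) (simp_all add: ac_simps)
    have "(\<Prod>i<k. ((1 - X i) ^ 3 - X i ^ 3 * A) / ((1 - Y i) ^ 3 + A)) * (\<Prod>i<k. D i) =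
        (\<Prod>i<k. (1 - u * X i) / (u - Y i)) * (\<Prod>i<k. E i)"
      unfolding prod.distrib[symmetric]
    proof (intro prod.cong refl)
      fix i assume "i \<in> {..<k}"
      with k have "i < h" by simp
      then show "((1 - X i) ^ 3 - X i ^ 3 * A) / ((1 - Y i) ^ 3 + A) * D i = (1 - u * X i) / (u - Y i) * E i"
        using unit_nonzero[OF unit_perturbed, of i]
        by (simp add: D_eq' flip: E_eq)
    qed
    then show ?thesis
      using split[of "h - k"] k by (simp add: T'_def c_eq_qpoch ac_simps)
  qed
  then have "(\<Sum>k\<le>h. T' k) * (\<Prod>i<h. D i) =
    (\<Sum>k\<le>h. (1 - q ^ (4*k+1)) / (1 - q) * (qpoch q (q^2) k / qpoch (q^2) (q^2) k)
        / q ^ (2*k^2+k) * (\<Prod>i<k. (1 - u * X i) / (u - Y i))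
        * ((\<Prod>i<k. E i) * (\<Prod>i<h-k. D (k + i))))"
    by (simp add: sum_distrib_right)
  also have "\<dots> = qpoch (q^3) (q^2) h * (\<Sum>j\<le>h. B j)"
  proof -
    have u': "u = 1 / q ^ (2*h+1)"
      unfolding u_def by (simp only: n_eq)
    show ?thesis
      unfolding B_def D_def E_def u' X_def Y_def by (rule watson_limit[OF q_nonzero q_not_root])
  qed
  finally show ?thesis .
qed

text \<open>The origin of the factor [n] on the right-hand side.\<close>

lemma qpoch_cube: "qpoch (q^3) (q^2) h = (1 - q ^ n) / (1 - q) * (\<Prod>i<h. 1 - X i)"
proof -
  have "q^3 * (q^2) ^ i = X (Suc i)" for i
  proof -
    have "q^3 * (q^2) ^ i = q ^ (3 + 2*i)"
      by (simp only: power_add power_mult)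
    then show ?thesis by (simp add: X_def numeral_3_eq_3)
  qed
  then have "(1 - X 0) * qpoch (q^3) (q^2) h = (\<Prod>i<Suc h. 1 - X i)"
    by (simp only: qpoch_def prod.lessThan_Suc_shift)
  moreover have "1 - X h = 1 - q ^ n" "X 0 = q"
    by (simp_all add: X_def n_eq)
  ultimately show ?thesis
    using q_not_root[of 1] by (simp add: field_simps)
qed

text \<open>The q-binomial contributes \<open>1 - 1 / (u * X j)\<close>, which completes
  \<open>E j\<close> to the cubic in \<open>E_eq\<close>, and \<open>ut_eq\<close> turns
  \<open>u * Y j\<close> times the lost factor \<open>t - X i\<close> into
  \<open>Y j + Y j * A - 1\<close>. So \<alpha> enters the ratio only through
  \<open>A\<close>.\<close>

lemma B_Suc:
  assumes "j < h"
  shows "B (Suc j) = B j * (((1 - X j) ^ 3 - X j ^ 3 * A) / (X j * ((1 - Y j) * (Y j + Y j * A - 1))))"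
proof -
  define i where "i = h - Suc j"
  have i: "h - j = Suc i" "h - Suc j = i" using assms by (auto simp: i_def)
  have Xi: "X i = 1 / (u * Y j)" using X_reflect_eq[OF assms] by (simp add: i_def)
  note nz = unit_nonzero[OF unit_one_minus_Y[OF assms]] u_nonzero
    unit_nonzero[OF unit_X[of j]] unit_nonzero[OF unit_Y[of j]]
  have q2: "\<And>i. i > 0 \<Longrightarrow> (q^2) ^ i \<noteq> 1"
    using q_not_root by (simp flip: power_mult)
  have q2Y: "(q^2) ^ Suc j = Y j"
    unfolding Y_def power_mult[symmetric] by simp
  have q2X: "(q^2) ^ (h - j) = 1 / (u * X j)"
  proof -
    have "(q^2) ^ (h - j) * X j = q ^ n"
      unfolding X_def power_mult[symmetric] power_add[symmetric]
      using assms by (intro arg_cong[where f = "power q"]) (simp add: n_eq)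
    then show ?thesis
      using nz q_nonzero by (simp add: u_def field_simps)
  qed
  have "(1 - Y j) * qbinom (q^2) h (Suc j) = (1 - 1 / (u * X j)) * qbinom (q^2) h j"
    using qbinom_Suc_right[OF q2, of j h] assms by (simp only: q2X q2Y less_imp_le)
  then have bin: "qbinom (q^2) h (Suc j) = (1 - 1 / (u * X j)) / (1 - Y j) * qbinom (q^2) h j"
    using nz by (simp add: eq_divide_eq mult.commute)
  have pw: "q ^ ((Suc j)^2 + Suc j) = q ^ (j^2+j) * Y j"
    unfolding Y_def power_add[symmetric] by (rule arg_cong[where f = "power q"]) (simp add: power2_eq_square)
  have "u * (Y j * (t - X i)) = Y j + Y j * A - 1"
  proof -
    have "u * (Y j * (t - X i)) = (u * t) * Y j - 1"
      using nz by (simp add: Xi algebra_simps)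
    then show ?thesis
      unfolding ut_eq by (simp add: algebra_simps)
  qed
  moreover have "Y j + Y j * A - 1 \<noteq> 0"
  proof -
    have 1: "cgr 3 (Y j + Y j * A - 1) (Y j + Y j * 0 - 1)"
      by (intro cgr_diff cgr_add cgr_mult_left A_0 cgr_refl) auto
    have "unit (Y j + Y j * A - 1)"
      using unit_cgr[OF 1] unit_minus[OF unit_one_minus_Y[OF assms]] by simp
    then show ?thesis by (rule unit_nonzero)
  qed
  ultimately have tX: "t - X i = (Y j + Y j * A - 1) / (u * Y j)" "t - X i \<noteq> 0"
    using nz by (auto simp: field_simps)
  have ratio: "((1 - X j) ^ 3 - X j ^ 3 * A) / (X j * ((1 - Y j) * (Y j + Y j * A - 1))) =
      - ((1 - 1 / (u * X j)) / (1 - Y j) * E j / (Y j * (t - X i)))"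
  proof -
    have "1 - 1 / (u * X j) = - ((1 - u * X j) / (u * X j))"
      using nz by (simp add: field_simps)
    then show ?thesis
      unfolding tX(1) E_eq[symmetric] using nz by simp
  qed
  have "B (Suc j) * (t - X i) = - ((-1) ^ j / q ^ (j^2+j) / Y j *
     ((1 - 1 / (u * X j)) / (1 - Y j) * qbinom (q^2) h j) * (\<Prod>i<j. E i) * E j * (\<Prod>i<Suc i. t - X i))"
    unfolding B_def bin pw i by simp
  also have "\<dots> = B j * (((1 - X j) ^ 3 - X j ^ 3 * A) / (X j * ((1 - Y j) * (Y j + Y j * A - 1)))) * (t - X i)"
    unfolding ratio B_def i using tX(2) by (simp add: ac_simps)
  finally show ?thesis
    using tX(2) mult_right_cancel by blast
qed

lemma b_in: "j \<le> h \<Longrightarrow> b j \<in> R"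
  unfolding b_def
  by (intro mult_in divide_in power_in prod_in unit_power unit_prod unit_one_minus_Y) auto

lemma B_in_0: "B 0 \<in> R"
  unfolding B_def by (auto intro!: prod_in)

lemma B_cong: "j \<le> h \<Longrightarrow> cgr 3 (B j) (B 0 * b j)"
proof (induction j)
  case 0
  then show ?case by (simp add: b_def)
next
  case (Suc j)
  then have j: "j < h" "j \<le> h" by auto
  note u = unit_one_minus_Y[OF j(1)]
  have 1: "cgr 3 (Y j + Y j * A - 1) (Y j + Y j * 0 - 1)"
      by (intro cgr_diff cgr_add cgr_mult_left A_0 cgr_refl) auto
  have u1: "unit (Y j - 1)"
    using unit_minus[OF u] by simp
  then have u2: "unit (Y j + Y j * A - 1)"
    using unit_cgr[OF 1] by simp
  have 2: "cgr 3 ((1 - X j) ^ 3 - X j ^ 3 * A) ((1 - X j) ^ 3 - X j ^ 3 * 0)"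
    by (intro cgr_diff cgr_mult_left A_0 cgr_refl) auto
  have "B (Suc j) = B j * (((1 - X j) ^ 3 - X j ^ 3 * A) / (X j * ((1 - Y j) * (Y j + Y j * A - 1))))"
    by (rule B_Suc[OF j(1)])
  also have "cgr 3 \<dots> (B 0 * b j * (((1 - X j) ^ 3 - X j ^ 3 * 0) / (X j * ((1 - Y j) * (Y j + Y j * 0 - 1)))))"
    using Suc.IH[OF j(2)] u u1 u2 1 2 b_in[OF j(2)] B_in_0
    by (intro cgr_mult[OF _ cgr_divide] cgr_mult_left unit_mult divide_in mult_in) (auto simp: unit_in)
  also have "\<dots> = B 0 * b (Suc j)"
  proof -
    have "q ^ ((Suc j)^2) = q ^ (j^2) * X j"
      unfolding X_def power_add[symmetric] by (rule arg_cong[where f = "power q"]) (simp add: power2_eq_square)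
    then have "b (Suc j) = b j * - ((1 - X j) ^ 3 / (X j * (1 - Y j)^2))"
      by (simp add: b_def power_mult_distrib ac_simps)
    moreover have "Y j + Y j * 0 - 1 = - (1 - Y j)"
      by simp
    then have "((1 - X j) ^ 3 - X j ^ 3 * 0) / (X j * ((1 - Y j) * (Y j + Y j * 0 - 1))) =
        - ((1 - X j) ^ 3 / (X j * (1 - Y j)^2))"
      by (simp only: power2_eq_square mult_minus_right minus_divide_right) simp
    ultimately show ?thesis
      by (simp only: mult.assoc)
  qed
  finally show ?case .
qed

lemma prefactor:
  "cgr 3 ((\<Prod>i<h. 1 - X i) * B 0 / (\<Prod>i<h. D i))
    (1 / q ^ h * (1 + (q ^ n - 1)^2 * ((of_nat n ^ 2 - 1) / 24)))"
proof -
  define f where "f i = Y i / (1 - Y i)^2" for i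
  define w where "w = \<alpha>^2 / u"
  have w_in: "w \<in> R"
    by (auto simp: w_def intro!: divide_in)
  have w_0: "cgr 2 w 0"
    using cgr_divide[OF \<alpha>2_0 cgr_refl, of u] by (simp add: w_def)
  have f_in: "f i \<in> R" if "i < h" for i
    unfolding f_def using that by (intro divide_in unit_power unit_one_minus_Y) auto
  have "(\<Prod>i<h. 1 - X i) * B 0 / (\<Prod>i<h. D i) =
      (\<Prod>i<h. (1 - X i) * (t - X i)) / (\<Prod>i<h. D i)"
    by (simp add: B_def prod.distrib)
  \<comment> \<open>Reversal puts \<open>X (h - Suc i)\<close> next to \<open>D i\<close>; both can
    be written with \<open>Y i\<close>, and the quotient is evaluated factor by factor.\<close>
  also have "(\<Prod>i<h. (1 - X i) * (t - X i)) = (\<Prod>i<h. (1 - X (h - Suc i)) * (t - X (h - Suc i)))"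
    by (rule prod.nat_diff_reindex[symmetric])
  also have "\<dots> / (\<Prod>i<h. D i) = (\<Prod>i<h. (1 - X (h - Suc i)) * (t - X (h - Suc i)) / D i)"
    by (simp add: prod_dividef)
  also have "cgr 3 \<dots> (\<Prod>i<h. 1 / (u * (Y i)^2) * (1 + w * - f i))"
  proof (rule cgr_prod)
    fix i assume "i \<in> {..<h}"
    then have i: "i < h" by simp
    note un = unit_one_minus_Y[OF i] unit_Y[of i] unit_perturbed[OF i] unit_u unit_u_minus_Y[OF i]
    note nz = un[THEN unit_nonzero]
    have e1: "1 - 1 / (u * Y i) = (u * Y i - 1) / (u * Y i)"
      using nz by (simp add: field_simps)
    have "t = (1 + A) / u"
      using ut_eq u_nonzero by (simp add: field_simps)
    then have e2: "t - 1 / (u * Y i) = ((1 + A) * Y i - 1) / (u * Y i)"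
      using nz by (simp add: field_simps)
    have "(1 - X (h - Suc i)) * (t - X (h - Suc i)) / D i =
        (u * Y i - 1) * (u - Y i) * ((1 + A) * Y i - 1) / (u^2 * (Y i)^2 * ((1 - Y i) ^ 3 + A))"
      unfolding X_reflect_eq[OF i] D_eq'[OF i] e1 e2 by (simp add: power2_eq_square ac_simps)
    also have "cgr 3 \<dots> ((u * Y i - 1) * (u - Y i) * ((1 + 0) * Y i - 1) / (u^2 * (Y i)^2 * ((1 - Y i) ^ 3 + 0)))"
      using un by (intro cgr_divide cgr_mult cgr_diff cgr_add cgr_refl A_0 unit_mult unit_power)
        (auto simp: unit_in unit_power)
    also have "\<dots> = 1 / (u * (Y i)^2) * (((1 - u * Y i) * (u - Y i)) / (u * (1 - Y i)^2))"
    proof -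
      have num: "(u * Y i - 1) * (u - Y i) * ((1 + 0) * Y i - 1) = (1 - u * Y i) * (u - Y i) * (1 - Y i)"
        by (simp add: algebra_simps)
      have den: "(1 - Y i) ^ 3 + 0 = (1 - Y i)^2 * (1 - Y i)"
        by (simp add: power3_eq_cube power2_eq_square)
      show ?thesis
        unfolding num den using nz(1) by (simp add: power2_eq_square[of u])
    qed
    \<comment> \<open>The absence of a term linear in \<alpha> makes the correction in the theorem
      quadratic.\<close>
    also have "(1 - u * Y i) * (u - Y i) = u * (1 - Y i)^2 - \<alpha>^2 * Y i"
      unfolding u_eq by algebra
    also have "1 / (u * (Y i)^2) * ((u * (1 - Y i)^2 - \<alpha>^2 * Y i) / (u * (1 - Y i)^2)) =
        1 / (u * (Y i)^2) * (1 + w * - f i)"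
      using nz by (simp add: w_def f_def diff_divide_distrib)
    finally show "cgr 3 ((1 - X (h - Suc i)) * (t - X (h - Suc i)) / D i)
        (1 / (u * (Y i)^2) * (1 + w * - f i))" .
    show "1 / (u * (Y i)^2) * (1 + w * - f i) \<in> R"
      using w_in f_in[OF i] by (intro mult_in divide_in unit_mult unit_power add_in minus_in) auto
  qed
  also have "\<dots> = (\<Prod>i<h. 1 / (u * (Y i)^2)) * (\<Prod>i<h. 1 + w * - f i)"
    by (rule prod.distrib)
  also have "(\<Prod>i<h. 1 / (u * (Y i)^2)) = 1 / q ^ h"
  proof -
    have Y2: "(\<Prod>i<m. (Y i)^2) = q ^ (2*m^2+2*m)" for m
    proof (induction m)
      case (Suc m)
      have "2 * (Suc m)^2 + 2 * Suc m = (2*m^2+2*m) + (2*m+2)*2"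
        by (simp add: power2_eq_square)
      with Suc show ?case
        by (simp only: prod.lessThan_Suc Y_def power_add power_mult)
    qed simp
    have "(\<Prod>i<h. 1 / (u * (Y i)^2)) = q ^ (n * h) / q ^ (2*h^2+2*h)"
      by (simp add: prod_dividef prod.distrib Y2 u_def power_divide power_mult del: power_Suc)
    also have "2*h^2+2*h = n * h + h"
      by (simp add: n_eq algebra_simps power2_eq_square)
    finally show ?thesis
      using q_nonzero by (simp add: power_add)
  qed
  also have "cgr 3 (1 / q ^ h * (\<Prod>i<h. 1 + w * - f i)) (1 / q ^ h * (1 + w * (\<Sum>i<h. - f i)))"
  proof (intro cgr_mult_left prod_one_plus_cgr)
    have "cgr (2 + 2) (w * w) (w * 0)"
      by (intro cgr_mult_zero w_0)
    then show "cgr 3 (w * w) 0"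
      by (auto intro: cgr_weaken[of 4])
  qed (auto intro!: w_in f_in minus_in divide_in)
  also have "cgr 3 \<dots> (1 / q ^ h * (1 + w * ((of_nat n ^ 2 - 1) / 24)))"
  proof -
    have "cgr 1 (\<Sum>i<h. - f i) ((of_nat n ^ 2 - 1) / 24)"
      using cgr_minus[OF sum_quotient] by (simp add: f_def sum_negf)
    then have "cgr 3 (w * (\<Sum>i<h. - f i)) (w * ((of_nat n ^ 2 - 1) / 24))"
      by (rule cgr_mult_zero'[OF w_0]) simp
    then show ?thesis
      by (intro cgr_mult_left[OF cgr_add[OF cgr_refl]] divide_in) auto
  qed
  \<comment> \<open>Exactly, \<open>w\<close> is \<open>(q ^ n - 1)^2 * u\<close>; the square
    supplies \<open>P ^ 2\<close>, so \<open>u\<close> may be replaced by 1.\<close>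
  also have "cgr 3 \<dots> (1 / q ^ h * (1 + (q ^ n - 1)^2 * ((of_nat n ^ 2 - 1) / 24)))"
  proof -
    let ?e = "q ^ n - 1"
    have e0: "cgr 1 ?e 0"
      using q_power_n cgr_diff[OF _ cgr_refl, of 1 "q ^ n" 1 1] by simp
    have e2: "cgr 2 (?e ^ 2) 0"
      using cgr_mult_zero[OF e0 e0] by (simp add: power2_eq_square numeral_2_eq_2)
    have "\<alpha> = - ?e * u"
      using q_nonzero by (simp add: \<alpha>_def u_def field_simps)
    then have "\<alpha>^2 = ?e ^ 2 * (u * u)"
      by (simp only: power_mult_distrib power2_minus power2_eq_square[of u])
    then have "w = ?e ^ 2 * u"
      using u_nonzero by (simp add: w_def)
    then have "w = ?e ^ 2 * (1 + \<alpha>)"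
      by (simp only: u_eq)
    moreover have "cgr (2 + 1) (?e ^ 2 * (1 + \<alpha>)) (?e ^ 2 * (1 + 0))"
      by (intro cgr_mult_zero e2 cgr_add cgr_refl \<alpha>_0)
    ultimately have "cgr 3 w (?e ^ 2)"
      by simp
    then show ?thesis
      by (intro cgr_mult_left cgr_add cgr_refl cgr_mult divide_in) auto
  qed
  finally show ?thesis .
qed

text \<open>The factor [n] accounts for one power of \<open>P\<close>, hence \<open>B_cong\<close>
  and \<open>prefactor\<close> suffice modulo \<open>P ^ 3\<close>.\<close>

lemma sum_T_cong:
  "cgr 4 (\<Sum>k\<le>h. T k) ((1 - q ^ n) / (1 - q) *
    (1 / q ^ h * (1 + (q ^ n - 1)^2 * ((of_nat n ^ 2 - 1) / 24))) * (\<Sum>j\<le>h. b j))"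
proof -
  have uD: "unit (\<Prod>i<h. D i)"
    by (intro unit_prod unit_D) auto
  have n0: "cgr 1 ((1 - q ^ n) / (1 - q)) 0"
    using cgr_divide[OF cgr_diff[OF cgr_refl[of 1 1] q_power_n] cgr_refl, of "1 - q"] by simp
  have b: "(\<Sum>j\<le>h. b j) \<in> R"
    by (auto intro: sum_in b_in)
  let ?F = "(\<Prod>i<h. 1 - X i) / (\<Prod>i<h. D i)"
  have F: "?F \<in> R"
    using uD by (auto intro!: divide_in prod_in)
  have "(\<Sum>k\<le>h. T' k) = (1 - q ^ n) / (1 - q) * (?F * (\<Sum>j\<le>h. B j))"
  proof -
    have "(\<Sum>k\<le>h. T' k) = qpoch (q^3) (q^2) h * (\<Sum>j\<le>h. B j) / (\<Prod>i<h. D i)"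
      using sum_T'_eq unit_nonzero[OF uD] by (simp add: eq_divide_eq)
    then show ?thesis
      by (simp add: qpoch_cube)
  qed
  also have "cgr 4 \<dots> ((1 - q ^ n) / (1 - q) *
    ((1 / q ^ h * (1 + (q ^ n - 1)^2 * ((of_nat n ^ 2 - 1) / 24))) * (\<Sum>j\<le>h. b j)))"
  proof -
    have "cgr 3 (?F * (\<Sum>j\<le>h. B j)) (?F * (\<Sum>j\<le>h. B 0 * b j))"
      by (intro cgr_mult_left F cgr_sum B_cong) auto
    also have "?F * (\<Sum>j\<le>h. B 0 * b j) = (\<Prod>i<h. 1 - X i) * B 0 / (\<Prod>i<h. D i) * (\<Sum>j\<le>h. b j)"
      by (simp flip: sum_distrib_left)
    also have "cgr 3 \<dots> (1 / q ^ h * (1 + (q ^ n - 1)^2 * ((of_nat n ^ 2 - 1) / 24)) * (\<Sum>j\<le>h. b j))"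
      using b by (intro cgr_mult prefactor cgr_refl mult_in divide_in add_in) auto
    finally show ?thesis
      by (rule cgr_mult_zero'[OF n0]) simp
  qed
  finally have "cgr 4 (\<Sum>k\<le>h. T' k) ((1 - q ^ n) / (1 - q) *
    ((1 / q ^ h * (1 + (q ^ n - 1)^2 * ((of_nat n ^ 2 - 1) / 24))) * (\<Sum>j\<le>h. b j)))" .
  with sum_T' show ?thesis
    unfolding mult.assoc by (rule cgr_trans)
qed

subsection \<open>Vanishing modulo proper cyclotomic factors\<close>

lemma not_dvd_2: "\<not> n dvd j \<Longrightarrow> \<not> n dvd 2 * j"
  using coprime_dvd_mult_right_iff[of n 2 j] by (simp add: n_eq)

text \<open>If \<open>n\<close> divides \<open>j\<close>, the value is congruent to 2; otherwise it
  is a quotient of two units, as \<open>n\<close> is odd. This inverts the denominator $(-q;q)_k^2$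
  in \<open>c_in\<close>.\<close>

lemma unit_one_plus_q_power: "unit (1 + q ^ j)"
proof (cases "n dvd j")
  case True
  then have "cgr 1 (1 + q ^ j) (1 + 1)"
    by (intro cgr_add q_power_1 cgr_refl)
  then show ?thesis
    by (rule unit_cgr) simp_all
next
  case False
  note u = unit_one_minus_q_power[OF False]
  have "unit ((1 - q ^ (2 * j)) / (1 - q ^ j))"
    by (intro unit_divide u unit_one_minus_q_power not_dvd_2 False)
  moreover have "1 - q ^ (2 * j) = (1 - q ^ j) * (1 + q ^ j)"
    by (simp add: mult_2 mult_2_right power_add algebra_simps)
  ultimately show ?thesis
    using unit_nonzero[OF u] by simp
qed

lemma qbinom_in: "p \<in> R \<Longrightarrow> qbinom p m k \<in> R"
  by (induction p m k rule: qbinom.induct) auto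

lemma one_minus_nonzero: "1 - X i \<noteq> 0" "1 - Y i \<noteq> 0"
  using q_not_root[of "2*i+1"] q_not_root[of "2*i+2"]
  unfolding X_def Y_def by (metis add_gr_0 zero_less_one zero_less_numeral right_minus_eq)+

text \<open>$(q;q^2)_k / (q^2;q^2)_k = \binom{2k}{k}_q / (-q;q)_k^2$\<close>

lemma c_in: "c k \<in> R"
proof -
  have 1: "qpoch q q (2 * k) = (\<Prod>i<k. 1 - X i) * (\<Prod>i<k. 1 - Y i)"
    by (induction k) (simp_all add: X_def Y_def ac_simps)
  have 2: "(\<Prod>i<k. 1 - Y i) = qpoch q q k * (\<Prod>i<k. 1 + q ^ Suc i)"
  proof -
    have "1 - Y i = (1 - q * q ^ i) * (1 + q ^ Suc i)" for i
      by (simp add: Y_def mult_2 mult_2_right power_add algebra_simps)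
    then show ?thesis
      by (simp only: qpoch_def prod.distrib)
  qed
  have nz: "(\<Prod>i<k. 1 - Y i) \<noteq> 0"
    using one_minus_nonzero by simp
  have u: "unit (\<Prod>i<k. 1 + q ^ Suc i)"
    by (intro unit_prod unit_one_plus_q_power)
  have "qbinom q (2 * k) k * (qpoch q q k * qpoch q q (2 * k - k)) = qpoch q q (2 * k)"
    by (rule qbinom_mult_qpoch) simp
  then have "qbinom q (2 * k) k * (qpoch q q k)^2 = (\<Prod>i<k. 1 - X i) * (\<Prod>i<k. 1 - Y i)"
    by (simp add: 1 power2_eq_square)
  then have "qbinom q (2 * k) k * (\<Prod>i<k. 1 - Y i)^2 =
      (\<Prod>i<k. 1 - X i) * (\<Prod>i<k. 1 - Y i) * (\<Prod>i<k. 1 + q ^ Suc i)^2"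
    unfolding 2 power_mult_distrib by (simp add: mult.assoc[symmetric])
  then have "c k = qbinom q (2 * k) k / (\<Prod>i<k. 1 + q ^ Suc i)^2"
    using nz unit_nonzero[OF u]
    by (simp add: c_def prod_dividef field_simps power2_eq_square[of "\<Prod>i<k. 1 - Y i"])
  then show ?thesis
    using u by (auto intro!: divide_in unit_power qbinom_in)
qed

text \<open>In contrast to \<open>b_in\<close>, \<open>k\<close> is unbounded: modulo a proper
  factor \<Phi>_d the sum runs beyond the local \<open>h\<close>.\<close>

lemma b_in': "b k \<in> R"
proof -
  have "b k = (-1) ^ k / q ^ (k^2) * (c k ^ 2 * (\<Prod>i<k. 1 - X i))"
    by (simp add: b_def c_def prod_dividef power_divide power2_eq_square power3_eq_cube)
  then show ?thesis
    by (auto intro!: mult_in divide_in power_in c_in prod_in)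
qed

text \<open>For \<open>k > h\<close> the numerator contains \<open>1 - X h = 1 - q ^ n\<close>,
  while \<open>k < n\<close> keeps every denominator a unit.\<close>

lemma c_eq_0:
  assumes "h < k" "k < n"
  shows "cgr 1 (c k) 0"
proof -
  have u: "unit (\<Prod>i<k. 1 - Y i)"
    using assms by (intro unit_prod unit_one_minus_Y') (auto simp: n_eq)
  have "(\<Prod>i<k. 1 - X i) = (1 - q ^ n) * (\<Prod>i\<in>{..<k} - {h}. 1 - X i)"
    using assms by (subst prod.remove[of _ h]) (auto simp: X_def n_eq)
  also have "cgr 1 \<dots> ((1 - 1) * (\<Prod>i\<in>{..<k} - {h}. 1 - X i))"
    by (intro cgr_mult cgr_diff cgr_refl q_power_n prod_in) auto
  finally have "cgr 1 (\<Prod>i<k. 1 - X i) 0"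
    by simp
  then have "cgr 1 ((\<Prod>i<k. 1 - X i) / (\<Prod>i<k. 1 - Y i)) (0 / (\<Prod>i<k. 1 - Y i))"
    using u by (intro cgr_divide cgr_refl) auto
  then show ?thesis
    by (simp add: c_def prod_dividef)
qed

lemma T_eq_0:
  assumes "h < k" "k < n"
  shows "cgr 4 (T k) 0"
proof -
  note c0 = c_eq_0[OF assms]
  have c2: "cgr 2 (c k * c k) (c k * 0)"
    by (rule cgr_mult_zero'[OF c0 c0]) simp
  then have c2: "cgr 2 (c k * c k) 0"
    by simp
  have "cgr 4 ((c k * c k) * (c k * c k)) ((c k * c k) * 0)"
    by (rule cgr_mult_zero'[OF c2 c2]) simp
  then have "cgr 4 ((1 - q ^ (4*k+1)) / (1 - q) / q ^ (2*k^2+k) * ((c k * c k) * (c k * c k)))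
      ((1 - q ^ (4*k+1)) / (1 - q) / q ^ (2*k^2+k) * ((c k * c k) * 0))"
    by (rule cgr_mult_left) (auto intro!: divide_in unit_mult)
  then show ?thesis
    by (simp add: T_def power4_eq_xxxx mult.assoc)
qed

lemma sum_T_tail: "cgr 4 (\<Sum>k<n. T k) (\<Sum>k\<le>h. T k)"
proof -
  have un: "{..<n} = {..h} \<union> {h<..<n}"
    using n_eq by auto
  have "(\<Sum>k<n. T k) = (\<Sum>k\<le>h. T k) + (\<Sum>k\<in>{h<..<n}. T k)"
    unfolding un by (rule sum.union_disjoint) auto
  also have "cgr 4 \<dots> ((\<Sum>k\<le>h. T k) + (\<Sum>k\<in>{h<..<n}. 0))"
    by (intro cgr_add cgr_refl cgr_sum T_eq_0) auto
  finally show ?thesis by simp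
qed

text \<open>The factors of \<open>c\<close> are periodic modulo \<open>P\<close> with period
  \<open>n\<close>. Only the last \<open>r\<close> of them are reduced one by one; the first
  \<open>n * l\<close> may have denominators divisible by \<open>P\<close> and are kept together as
  \<open>c (n * l)\<close>, which lies in \<open>R\<close> by \<open>c_in\<close>.\<close>

lemma T_block:
  assumes "r < n"
  shows "cgr 1 (T (n * l + r)) (c (n * l) ^ 4 * T r)"
proof -
  have cgX: "cgr 1 (X (n * l + i)) (X i)" "cgr 1 (Y (n * l + i)) (Y i)" for i
    unfolding X_def Y_def
    by (rule q_power_cong[of _ 0 _ "2*l"]; simp add: algebra_simps)+
  have unY: "unit (1 - Y (n * l + i))" if "i < 2 * h" for i
  proof -
    have "cgr 1 (1 - Y (n * l + i)) (1 - Y i)"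
      by (intro cgr_diff cgr_refl cgX)
    then show ?thesis
      by (rule unit_cgr) (use that unit_one_minus_Y' in auto)
  qed
  have "c (n * l + m) = c (n * l) * (\<Prod>i<m. (1 - X (n * l + i)) / (1 - Y (n * l + i)))" for m
    by (induction m) (simp_all add: c_def ac_simps)
  moreover have "cgr 1 (\<Prod>i<r. (1 - X (n * l + i)) / (1 - Y (n * l + i))) (c r)"
    unfolding c_def
  proof (intro cgr_prod cgr_divide cgr_diff cgr_refl cgX)
    fix i assume "i \<in> {..<r}"
    then have "i < 2 * h" using assms by (simp add: n_eq)
    then show "unit (1 - Y (n * l + i))" "unit (1 - Y i)"
      by (fact unY unit_one_minus_Y')+
    then show "(1 - X i) / (1 - Y i) \<in> R"
      by (auto intro!: divide_in)
  qed auto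
  ultimately have "cgr 1 (c (n * l + r)) (c (n * l) * c r)"
    by (simp add: cgr_mult_left c_in)
  then have "cgr 1 (c (n * l + r) ^ 4) ((c (n * l) * c r) ^ 4)"
    by (intro cgr_power) (simp_all add: c_in)
  moreover have "cgr 1 (q ^ (4*(n * l + r)+1)) (q ^ (4*r+1))"
    by (rule q_power_cong[of _ 0 _ "4*l"]) (simp add: algebra_simps)
  moreover have "cgr 1 (q ^ (2*(n * l + r)^2+(n * l + r))) (q ^ (2*r^2+r))"
    by (rule q_power_cong[of _ 0 _ "2*n*l*l+4*l*r+l"]) (simp add: algebra_simps power2_eq_square)
  ultimately have "cgr 1 (T (n * l + r))
      ((1 - q ^ (4*r+1)) / (1 - q) * (c (n * l) * c r) ^ 4 / q ^ (2*r^2+r))"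
    unfolding T_def
    by (intro cgr_divide cgr_mult cgr_diff cgr_refl mult_in power_in divide_in) (auto simp: c_in)
  then show ?thesis
    by (simp add: T_def power_mult_distrib ac_simps)
qed

lemma sum_T_block: "cgr 1 (\<Sum>k<n * m. T k) 0"
proof (induction m)
  case 0
  then show ?case by simp
next
  case (Suc m)
  have "(\<Sum>k<n * m + j. T k) = (\<Sum>k<n * m. T k) + (\<Sum>r<j. T (n * m + r))" for j
    by (induction j) simp_all
  from this[of n] have "(\<Sum>k<n * Suc m. T k) = (\<Sum>k<n * m. T k) + (\<Sum>r<n. T (n * m + r))"
    by (simp add: add.commute)
  also have "cgr 1 \<dots> (0 + (\<Sum>r<n. c (n * m) ^ 4 * T r))"
    by (intro cgr_add Suc.IH cgr_sum T_block) auto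
  also have "(\<Sum>r<n. c (n * m) ^ 4 * T r) = c (n * m) ^ 4 * (\<Sum>r<n. T r)"
    by (rule sum_distrib_left[symmetric])
  also have "cgr 1 (0 + \<dots>) (0 + c (n * m) ^ 4 * 0)"
    using cgr_trans[OF cgr_weaken[OF sum_T_tail] sum_T]
    by (intro cgr_add cgr_refl cgr_mult_left) (auto simp: c_in)
  finally show ?case by simp
qed

lemma sum_T_eq_0:
  assumes "odd m" and "M = (n * m - 1) div 2 \<or> M = n * m - 1"
  shows "cgr 1 (\<Sum>k\<le>M. T k) 0"
  using assms(2)
proof
  assume "M = n * m - 1"
  moreover have "n * m > 0" using assms(1) by (auto simp: n_eq odd_pos)
  ultimately have "Suc M = n * m"
    by simp
  then have "{..M} = {..<n * m}"
    by (metis lessThan_Suc_atMost)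
  then show ?thesis using sum_T_block by simp
next
  assume M: "M = (n * m - 1) div 2"
  obtain l where "m = 2 * l + 1" using assms(1) by (elim oddE)
  \<comment> \<open>The range consists of \<open>l\<close> full blocks and the first half, up to
    \<open>h\<close>, of another one.\<close>
  then have "n * m - 1 = 2 * (n * l + h)"
    by (simp add: n_eq algebra_simps)
  with M have M': "M = n * l + h" by simp
  have "(\<Sum>k\<le>n * l + j. T k) = (\<Sum>k<n * l. T k) + (\<Sum>r\<le>j. T (n * l + r))" for j
    by (induction j) (simp_all flip: lessThan_Suc_atMost)
  then have "(\<Sum>k\<le>M. T k) = (\<Sum>k<n * l. T k) + (\<Sum>r\<le>h. T (n * l + r))"
    by (simp only: M')
  also have "cgr 1 \<dots> (0 + (\<Sum>r\<le>h. c (n * l) ^ 4 * T r))"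
    by (intro cgr_add sum_T_block cgr_sum T_block) (auto simp: n_eq)
  also have "(\<Sum>r\<le>h. c (n * l) ^ 4 * T r) = c (n * l) ^ 4 * (\<Sum>r\<le>h. T r)"
    by (rule sum_distrib_left[symmetric])
  also have "cgr 1 (0 + \<dots>) (0 + c (n * l) ^ 4 * 0)"
    by (intro cgr_add cgr_refl cgr_mult_left sum_T) (auto simp: c_in)
  finally show ?thesis by simp
qed

end

section \<open>Rational functions regular at primitive roots of unity\<close>

definition loc :: "rat poly \<Rightarrow> rat poly fract set"
  where "loc P = {to_fract a / to_fract b | a b. b \<noteq> 0 \<and> coprime b P}"

lemma locI: "x = to_fract a / to_fract b \<Longrightarrow> b \<noteq> 0 \<Longrightarrow> coprime b P \<Longrightarrow> x \<in> loc P"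
  by (auto simp: loc_def)

lemma to_fract_in_loc: "to_fract a \<in> loc P"
  by (rule locI[of _ a 1]) auto

text \<open>Passes from the local ring to numerators in lowest terms: the denominator of
  \<open>z\<close> is coprime to \<open>P\<close> and cannot absorb any power of it.\<close>

lemma dvd_numerator:
  assumes "Z = to_fract P ^ k * z" and "z \<in> loc P"
  shows "P ^ k dvd fst (quot_of_fract Z)"
proof -
  obtain a b where ab: "b \<noteq> 0" "coprime b P" "z = to_fract a / to_fract b"
    using assms(2) by (auto simp: loc_def)
  define s where "s = fst (quot_of_fract Z)"
  define t where "t = snd (quot_of_fract Z)"
  have "t \<noteq> 0"
    by (simp add: t_def)
  have "Z = to_fract s / to_fract t"
    unfolding s_def t_def by (metis Fract_conv_to_fract Fract_quot_of_fract)
  with assms(1) ab have "to_fract (s * b) = to_fract (P ^ k * a * t)"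
    using \<open>t \<noteq> 0\<close> by (simp add: field_simps to_fract_power')
  then have "s * b = P ^ k * a * t"
    by (simp only: to_fract_eq_iff)
  then have "P ^ k dvd s * b"
    by (metis dvd_triv_left mult.assoc)
  moreover have "coprime (P ^ k) b"
    using ab(2) by (simp add: coprime_commute)
  ultimately show ?thesis
    using coprime_dvd_mult_left_iff unfolding s_def by blast
qed

section \<open>Roots and coprimality of cyclotomic polynomials\<close>

lemma cyclotomic_root_iff:
  assumes "n > 0"
  shows "poly (map_poly of_rat (cyclotomic n)) z = 0 \<longleftrightarrow> z \<in> primitive_roots_unity n"
  unfolding map_poly_cyclotomic[OF assms] poly_prod
  using finite_primitive_roots_unity[OF assms] by (auto simp: prod_zero_iff)

lemma cyclotomic_nonzero: "n > 0 \<Longrightarrow> cyclotomic n \<noteq> 0"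
proof
  assume n: "n > 0" and "cyclotomic n = 0"
  then have "(\<Prod>z\<in>primitive_roots_unity n. [:- z, 1:]) = (0 :: complex poly)"
    using map_poly_cyclotomic[OF n] by simp
  then show False
    using finite_primitive_roots_unity[OF n] by (auto simp: prod_zero_iff)
qed

text \<open>A nonconstant common divisor has a complex root, which is then a primitive n-th root of
  unity at which \<open>p\<close> vanishes.\<close>

lemma coprime_cyclotomicI:
  assumes "n > 0" and "\<And>z. z \<in> primitive_roots_unity n \<Longrightarrow> poly (map_poly of_rat p) z \<noteq> 0"
  shows "coprime p (cyclotomic n)"
proof (rule coprimeI)
  fix g assume g: "g dvd p" "g dvd cyclotomic n"
  let ?h = "map_poly of_rat :: rat poly \<Rightarrow> complex poly"
  have "g \<noteq> 0" using g(2) cyclotomic_nonzero[OF assms(1)] by auto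
  have dvd: "?h a dvd ?h b" if "a dvd b" for a b
    using that by (elim dvdE) (simp add: map_poly_of_rat_mult)
  have "degree g = 0"
  proof (rule ccontr)
    assume "degree g \<noteq> 0"
    moreover have "degree (?h g) = degree g"
      by (rule degree_map_poly) auto
    ultimately have "\<not> constant (poly (?h g))"
      by (simp add: constant_degree)
    then obtain z where "poly (?h g) z = 0"
      using fundamental_theorem_of_algebra by blast
    then have "poly (?h p) z = 0" "poly (?h (cyclotomic n)) z = 0"
      using dvd[OF g(1)] dvd[OF g(2)] by (auto elim!: dvdE)
    then show False
      using assms cyclotomic_root_iff by blast
  qed
  with \<open>g \<noteq> 0\<close> show "is_unit g"
    by (simp add: is_unit_iff_degree)
qed

lemma coprime_cyclotomic_cyclotomic:
  assumes "a > 0" "b > 0" "a \<noteq> b"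
  shows "coprime (cyclotomic a) (cyclotomic b)"
  using primitive_roots_unity_disjoint[OF assms] assms
  by (intro coprime_cyclotomicI) (auto simp: cyclotomic_root_iff)

lemma primitive_root_power_eq_1D:
  assumes "z \<in> primitive_roots_unity n" "z ^ j = 1" "n > 0"
  shows "n dvd j"
proof -
  have z: "z ^ n = 1" "\<And>m. 0 < m \<Longrightarrow> m < n \<Longrightarrow> z ^ m \<noteq> 1"
    using assms(1) by (auto simp: primitive_roots_unity_def)
  have "z ^ j = (z ^ n) ^ (j div n) * z ^ (j mod n)"
    by (metis mult_div_mod_eq power_add power_mult)
  with z(1) assms(2) have "z ^ (j mod n) = 1"
    by simp
  with z(2)[of "j mod n"] assms(3) have "j mod n = 0"
    using mod_less_divisor by blast
  then show ?thesis by (simp add: mod_eq_0_iff_dvd)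
qed

lemma primitive_root_exists:
  assumes "n > 0"
  obtains z where "z \<in> primitive_roots_unity n"
proof
  let ?f = "\<lambda>k. cis (2 * pi * real k / real n)"
  have inj: "inj_on ?f {..<n}"
    using bij_betw_roots_unity[OF assms] by (rule bij_betw_imp_inj_on)
  have pow: "?f 1 ^ m = ?f m" for m
    by (simp add: DeMoivre mult.commute)
  show "?f 1 \<in> primitive_roots_unity n"
    unfolding primitive_roots_unity_def
  proof safe
    show "?f 1 ^ n = 1"
      unfolding pow using assms by simp
    fix m assume "0 < m" "m < n" "?f 1 ^ m = 1"
    then have "?f m = ?f 0"
      unfolding pow by simp
    then show False
      using inj_onD[OF inj, of m 0] \<open>0 < m\<close> \<open>m < n\<close> by simp
  qed
qed

lemma map_poly_of_rat_X_power: "map_poly of_rat ([:0, 1:] ^ j) = (monom 1 j :: complex poly)"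
proof -
  have "[:0, 1:] ^ j = (monom 1 j :: rat poly)"
    by (simp add: monom_altdef)
  then show ?thesis
    by (simp add: map_poly_monom)
qed

lemma prod_cyclotomic:
  assumes "n > 0"
  shows "(\<Prod>d\<in>{d. d dvd n}. cyclotomic d) = [:0, 1:] ^ n - 1"
proof -
  have "map_poly of_rat (\<Prod>d\<in>{d. d dvd n}. cyclotomic d) =
      (\<Prod>d\<in>{d. d dvd n}. \<Prod>z\<in>primitive_roots_unity d. [:- z, 1 :: complex:])"
    unfolding map_poly_of_rat_prod
  proof (rule prod.cong[OF refl])
    fix d assume "d \<in> {d. d dvd n}"
    then have "d > 0" using assms by (auto intro: Nat.gr0I)
    then show "map_poly of_rat (cyclotomic d) = (\<Prod>z\<in>primitive_roots_unity d. [:- z, 1 :: complex:])"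
      by (rule map_poly_cyclotomic)
  qed
  also have "\<dots> = monom 1 n - 1"
    by (rule prod_primitive_roots_unity[OF assms])
  also have "\<dots> = map_poly of_rat ([:0, 1:] ^ n - 1)"
    by (simp add: map_poly_of_rat_diff map_poly_of_rat_X_power)
  finally show ?thesis
    by (simp only: map_poly_of_rat_eq_iff)
qed

lemma qnum_eq_prod_cyclotomic:
  assumes "n > 0"
  shows "qnum [:0, 1:] n = (\<Prod>d\<in>{d. d dvd n} - {1}. cyclotomic d)"
proof -
  have "cyclotomic 1 = [:0, 1:] - 1"
    using prod_cyclotomic[of 1] by simp
  then have "(1 - [:0, 1:]) * (\<Prod>d\<in>{d. d dvd n} - {1}. cyclotomic d) =
      - (\<Prod>d\<in>{d. d dvd n}. cyclotomic d)"
  proof -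
    have "(\<Prod>d\<in>{d. d dvd n}. cyclotomic d) = cyclotomic 1 * (\<Prod>d\<in>{d. d dvd n} - {1}. cyclotomic d)"
      using assms by (intro prod.remove) auto
    then show ?thesis
      unfolding \<open>cyclotomic 1 = _\<close> by (metis minus_diff_eq mult_minus_left)
  qed
  also have "\<dots> = 1 - [:0, 1:] ^ n"
    by (simp add: prod_cyclotomic[OF assms])
  finally have "1 - [:0, 1:] ^ n = (1 - [:0, 1:]) * (\<Prod>d\<in>{d. d dvd n} - {1}. cyclotomic d)" ..
  moreover have "1 - [:0, 1 :: rat:] \<noteq> 0"
    by (simp add: one_pCons)
  ultimately show ?thesis
    unfolding qnum_def by simp
qed

lemma cyclotomic_localization_cyclotomic:
  assumes "odd n" "n > 1"
  shows "cyclotomic_localization (loc (cyclotomic n)) (to_fract (cyclotomic n)) \<q> n (n div 2)"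
proof
  let ?P = "cyclotomic n"
  let ?R = "loc ?P"
  have n: "n > 0" using assms by simp
  have q_power: "\<q> ^ j = to_fract ([:0, 1:] ^ j)" for j
    by (simp add: qvar_def to_fract_power')
  have nonunit: "\<not> is_unit ?P"
  proof
    assume "is_unit ?P"
    then obtain r where r: "?P * r = 1"
      by (metis dvdE)
    obtain z where z: "z \<in> primitive_roots_unity n"
      using primitive_root_exists[OF n] by blast
    have "map_poly of_rat ?P * map_poly of_rat r = (1 :: complex poly)"
      unfolding map_poly_of_rat_mult[symmetric] r by simp
    then have "poly (map_poly of_rat ?P) z * poly (map_poly of_rat r) z = 1"
      by (metis poly_1 poly_mult)
    moreover have "poly (map_poly of_rat ?P) z = 0"
      using z cyclotomic_root_iff[OF n] by blast
    ultimately show False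
      by simp
  qed
  show "1 \<in> ?R"
    using to_fract_in_loc[of 1 ?P] by simp
  show "to_fract ?P \<in> ?R"
    by (rule to_fract_in_loc)
  show "\<q> \<in> ?R"
    unfolding qvar_def by (rule to_fract_in_loc)
  show "x - y \<in> ?R" "x * y \<in> ?R" if xy: "x \<in> ?R" "y \<in> ?R" for x y
  proof -
    obtain a b a' b' where ab: "x = to_fract a / to_fract b" "b \<noteq> 0" "coprime b ?P"
      "y = to_fract a' / to_fract b'" "b' \<noteq> 0" "coprime b' ?P"
      using xy by (auto simp: loc_def)
    show "x - y \<in> ?R"
      by (rule locI[of _ "a * b' - a' * b" "b * b'"]) (use ab(2,3,5,6) in \<open>simp_all add: ab(1,4) diff_frac_eq\<close>)
    show "x * y \<in> ?R"
      by (rule locI[of _ "a * a'" "b * b'"]) (use ab(2,3,5,6) in \<open>simp_all add: ab(1,4)\<close>)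
  qed
  show "inverse \<q> \<in> ?R"
  proof (rule locI[of _ 1 "[:0, 1:]"])
    show "coprime [:0, 1:] ?P"
      using n by (intro coprime_cyclotomicI) (auto simp: primitive_roots_unity_def map_poly_pCons power_0_left)
  qed (auto simp: qvar_def field_simps)
  show "n = 2 * (n div 2) + 1" "n div 2 > 0"
    using assms by auto
  have "?P dvd [:0, 1:] ^ n - 1"
    unfolding prod_cyclotomic[OF n, symmetric] using n by (intro dvd_prodI) auto
  then obtain r where "[:0, 1:] ^ n - 1 = ?P * r" ..
  then have "\<q> ^ n - 1 = to_fract ?P * to_fract r"
    unfolding q_power by (metis to_fract_1 to_fract_diff to_fract_mult)
  then show "\<exists>z\<in>?R. \<q> ^ n - 1 = to_fract ?P * z"
    using to_fract_in_loc by blast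
  have power_neq: "[:0, 1 :: rat:] ^ i \<noteq> 1" if "i > 0" for i
  proof
    assume "[:0, 1 :: rat:] ^ i = 1"
    then have "poly ([:0, 1 :: rat:] ^ i) 0 = poly 1 0" by simp
    with that show False by (simp add: poly_power power_0_left)
  qed
  show "inverse (1 - \<q> ^ j) \<in> ?R" if "\<not> n dvd j" for j
  proof (rule locI[of _ 1 "1 - [:0, 1:] ^ j"])
    show "coprime (1 - [:0, 1:] ^ j) ?P"
    proof (rule coprime_cyclotomicI[OF n])
      fix z assume "z \<in> primitive_roots_unity n"
      then have "z ^ j \<noteq> 1"
        using primitive_root_power_eq_1D that n by blast
      then show "poly (map_poly of_rat (1 - [:0, 1:] ^ j)) z \<noteq> 0"
        by (simp add: map_poly_of_rat_diff map_poly_of_rat_X_power poly_monom)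
    qed
    show "1 - [:0, 1:] ^ j \<noteq> (0 :: rat poly)"
      using power_neq[of j] that by (cases "j = 0") auto
    show "inverse (1 - \<q> ^ j) = to_fract 1 / to_fract (1 - [:0, 1:] ^ j)"
      by (simp add: q_power field_simps)
  qed
  show "1 + to_fract ?P * x \<noteq> 0" "inverse (1 + to_fract ?P * x) \<in> ?R" if x: "x \<in> ?R" for x
  proof -
    obtain a b where ab: "x = to_fract a / to_fract b" "b \<noteq> 0" "coprime b ?P"
      using x by (auto simp: loc_def)
    have cop: "coprime (b + ?P * a) ?P"
      using ab(3) by (metis coprime_iff_gcd_eq_1 gcd.commute gcd_add_mult mult.commute add.commute)
    \<comment> \<open>Zero is coprime only to units, and the cyclotomic polynomial is not
      one.\<close>
    then have nz: "b + ?P * a \<noteq> 0"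
      using nonunit by auto
    have e: "1 + to_fract ?P * x = to_fract (b + ?P * a) / to_fract b"
      using ab by (simp add: field_simps)
    show "1 + to_fract ?P * x \<noteq> 0"
      unfolding e using nz ab(2) by (metis divide_eq_0_iff to_fract_eq_0_iff)
    show "inverse (1 + to_fract ?P * x) \<in> ?R"
      unfolding e by (rule locI[OF _ nz cop, of _ b]) simp
  qed
  show "inverse (of_nat m) \<in> ?R" for m
  proof (cases "m = 0")
    case False
    have "to_fract (of_nat m :: rat poly) = of_nat m" for m
      by (induction m) auto
    then have "to_fract [:1 / of_nat m :: rat:] * of_nat m = to_fract ([:1 / of_nat m :: rat:] * of_nat m)"
      by (simp only: to_fract_mult)
    also have "[:1 / of_nat m :: rat:] * of_nat m = 1"
      using False by (simp add: of_nat_poly one_pCons)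
    finally have "inverse (of_nat m) = to_fract [:1 / of_nat m :: rat:]"
      using False by (simp add: field_simps)
    then show ?thesis
      by (simp only: to_fract_in_loc)
  qed (use to_fract_in_loc[of 0 ?P] in simp)
  show "\<q> \<noteq> 0"
    by (simp add: qvar_def)
  show "\<q> ^ i \<noteq> 1" if "i > 0" for i
    unfolding q_power using power_neq[OF that] by (metis to_fract_1 to_fract_eq_iff)
qed

section \<open>From local congruences to the full modulus\<close>

lemma prod_dvd_if_pairwise_coprime:
  fixes f :: "'b \<Rightarrow> 'a::semiring_gcd"
  assumes "\<And>i. i \<in> I \<Longrightarrow> f i dvd x"
    and "\<And>i j. i \<in> I \<Longrightarrow> j \<in> I \<Longrightarrow> i \<noteq> j \<Longrightarrow> coprime (f i) (f j)"
  shows "prod f I dvd x"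
  using assms
proof (induction I rule: infinite_finite_induct)
  case (insert i I)
  have "coprime (f i) (prod f I)"
    using insert.hyps insert.prems(2) by (intro prod_coprime_right) auto
  moreover have "f i dvd x" "prod f I dvd x"
    using insert by auto
  ultimately show ?case
    using insert.hyps by (simp add: divides_mult)
qed auto

text \<open>The modulus is a product of pairwise coprime powers of \<Phi>_d over the divisors d > 1
  of \<open>n\<close>. The exponent is 1 except for d = n, where [n] adds one to the given
  3.\<close>

lemma ratfun_congI:
  assumes "n > 1"
    and "\<And>d. d dvd n \<Longrightarrow> d > 1 \<Longrightarrow> \<exists>z\<in>loc (cyclotomic d). x - y = to_fract (cyclotomic d) ^ 1 * z"
    and "\<exists>z\<in>loc (cyclotomic n). x - y = to_fract (cyclotomic n) ^ 4 * z"
  shows "ratfun_cong x y (qnum [:0, 1:] n * cyclotomic n ^ 3)"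
proof -
  let ?I = "{d. d dvd n} - {1}"
  define e where "e d = (if d = n then 4 else 1 :: nat)" for d
  have pos: "d > 1" if "d \<in> ?I" for d
  proof -
    have "d \<noteq> 0" "d \<noteq> 1"
      using that assms(1) by (auto intro: Nat.gr0I)
    then show ?thesis by simp
  qed
  have "(\<Prod>d\<in>?I. cyclotomic d ^ e d) dvd fst (quot_of_fract (x - y))"
  proof (rule prod_dvd_if_pairwise_coprime)
    fix d assume d: "d \<in> ?I"
    have "\<exists>z\<in>loc (cyclotomic d). x - y = to_fract (cyclotomic d) ^ e d * z"
      using assms(2)[of d] assms(3) d pos[OF d] by (auto simp: e_def)
    then show "cyclotomic d ^ e d dvd fst (quot_of_fract (x - y))"
      using dvd_numerator by blast
  next
    fix a b assume "a \<in> ?I" "b \<in> ?I" "a \<noteq> b"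
    then show "coprime (cyclotomic a ^ e a) (cyclotomic b ^ e b)"
      using pos[of a] pos[of b] by (simp add: coprime_cyclotomic_cyclotomic)
  qed
  also have "(\<Prod>d\<in>?I. cyclotomic d ^ e d) = cyclotomic n ^ 4 * (\<Prod>d\<in>?I - {n}. cyclotomic d)"
    using assms(1) by (subst prod.remove[of _ n]) (auto simp: e_def intro!: prod.cong)
  also have "\<dots> = (\<Prod>d\<in>?I. cyclotomic d) * cyclotomic n ^ 3"
    using assms(1) by (subst (2) prod.remove[of _ n]) (auto simp: power4_eq_xxxx power3_eq_cube ac_simps)
  finally have "(\<Prod>d\<in>?I. cyclotomic d) * cyclotomic n ^ 3 dvd fst (quot_of_fract (x - y))" .
  moreover have "n > 0"
    using assms(1) by simp
  ultimately show ?thesis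
    by (simp only: ratfun_cong_def qnum_eq_prod_cyclotomic)
qed

theorem corollary2p7:
  fixes n M :: nat
  assumes "n > 0" and "odd n"
    and "M = (n - 1) div 2 \<or> M = n - 1"
  shows "ratfun_cong
    (\<Sum>k=0..M. qnum \<q> (4 * k + 1) * (qpoch \<q> (\<q> ^ 2) k ^ 4 / qpoch (\<q> ^ 2) (\<q> ^ 2) k ^ 4)
        * \<q> powi (- 2 * int k ^ 2 - int k))
    (qnum \<q> n * \<q> powi ((1 - int n) div 2)
      * (1 + qnum \<q> n ^ 2 * (((of_nat n ^ 2 - 1) * (1 - \<q>) ^ 2) / 24))
      * (\<Sum>k=0..(n - 1) div 2. qpoch \<q> (\<q> ^ 2) k ^ 3 / qpoch (\<q> ^ 2) (\<q> ^ 2) k ^ 2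
          * (- \<q>) powi (- (int k ^ 2))))
    (qnum [:0, 1:] n * cyclotomic n ^ 3)"
proof (cases "n = 1")
  \<comment> \<open>The locale demands \<open>h > 0\<close>, which excludes \<open>n = 1\<close>;
    there both sides equal 1.\<close>
  case True
  with assms(3) have "M = 0" by simp
  then show ?thesis
    using True qvar_neq_1 by (simp add: ratfun_cong_def qnum_field)
next
  case False
  with assms have n: "n > 1" by simp
  define h where "h = n div 2"
  have h: "n = 2 * h + 1" "(n - 1) div 2 = h"
    using assms(2) by (auto simp: h_def elim!: oddE)
  \<comment> \<open>As exported constants, \<open>T\<close> and \<open>b\<close> depend on
    \<open>\<q>\<close> alone, so the same sums are meant in the interpretations for
    \<open>n\<close> and for each divisor \<open>d\<close>.\<close>
  define T where "T = cyclotomic_localization.T \<q>"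
  define b where "b = cyclotomic_localization.b \<q>"
  interpret N: cyclotomic_localization "loc (cyclotomic n)" "to_fract (cyclotomic n)" \<q> n h
    unfolding h_def using assms(2) n by (rule cyclotomic_localization_cyclotomic)
  let ?S = "\<Sum>k\<le>M. T k"
  let ?W = "(1 - \<q> ^ n) / (1 - \<q>) *
    (1 / \<q> ^ h * (1 + (\<q> ^ n - 1)^2 * ((of_nat n ^ 2 - 1) / 24))) * (\<Sum>j\<le>h. b j)"
  have lhs: "(\<Sum>k=0..M. qnum \<q> (4 * k + 1) * (qpoch \<q> (\<q> ^ 2) k ^ 4 / qpoch (\<q> ^ 2) (\<q> ^ 2) k ^ 4)
        * \<q> powi (- 2 * int k ^ 2 - int k)) = ?S"
    unfolding atLeast0AtMost
  proof (rule sum.cong[OF refl])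
    fix k
    have "- 2 * int k ^ 2 - int k = - int (2 * k^2 + k)"
      by simp
    then show "qnum \<q> (4 * k + 1) * (qpoch \<q> (\<q> ^ 2) k ^ 4 / qpoch (\<q> ^ 2) (\<q> ^ 2) k ^ 4)
        * \<q> powi (- 2 * int k ^ 2 - int k) = T k"
      by (simp only: power_int_minus power_int_of_nat)
        (simp add: T_def N.T_def N.c_eq_qpoch qnum_field power_divide divide_inverse power_mult_distrib power_inverse)
  qed
  have rhs: "qnum \<q> n * \<q> powi ((1 - int n) div 2)
      * (1 + qnum \<q> n ^ 2 * (((of_nat n ^ 2 - 1) * (1 - \<q>) ^ 2) / 24))
      * (\<Sum>k=0..(n - 1) div 2. qpoch \<q> (\<q> ^ 2) k ^ 3 / qpoch (\<q> ^ 2) (\<q> ^ 2) k ^ 2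
          * (- \<q>) powi (- (int k ^ 2))) = ?W"
  proof -
    have "(1 - int n) div 2 = - int h"
      by (simp add: h(1))
    then have 1: "\<q> powi ((1 - int n) div 2) = 1 / \<q> ^ h"
      by (simp only: power_int_minus power_int_of_nat inverse_eq_divide)
    have 2: "qnum \<q> n ^ 2 * (((of_nat n ^ 2 - 1) * (1 - \<q>) ^ 2) / 24) =
        (\<q> ^ n - 1)^2 * ((of_nat n ^ 2 - 1) / 24)"
      using qvar_neq_1 by (simp add: qnum_field power_divide power2_commute[of 1])
    have 3: "qpoch \<q> (\<q> ^ 2) k ^ 3 / qpoch (\<q> ^ 2) (\<q> ^ 2) k ^ 2 * (- \<q>) powi (- (int k ^ 2)) = b k" for k
    proof -
      have "- (int k ^ 2) = - int (k ^ 2)"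
        by simp
      then have "(- \<q>) powi (- (int k ^ 2)) = 1 / (- \<q>) ^ (k ^ 2)"
        by (simp only: power_int_minus power_int_of_nat inverse_eq_divide)
      also have "(- \<q>) ^ (k ^ 2) = (-1) ^ k * \<q> ^ (k ^ 2)"
        by (subst power_minus) (simp add: minus_one_power_iff)
      also have "1 / ((-1) ^ k * \<q> ^ (k ^ 2)) = (-1) ^ k / \<q> ^ (k ^ 2)"
        by (simp add: minus_one_power_iff)
      finally show ?thesis
        by (simp add: b_def N.b_def N.prod_eq_qpoch ac_simps)
    qed
    show ?thesis
      unfolding 1 2 3 h(2) by (simp add: qnum_field atLeast0AtMost mult.assoc)
  qed
  show ?thesis
    unfolding lhs rhs
  proof (rule ratfun_congI[OF n])
    fix d assume d: "d dvd n" "d > 1"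
    then obtain m where m: "n = d * m" by blast
    with assms(2) have odd: "odd d" "odd m" by auto
    interpret D: cyclotomic_localization "loc (cyclotomic d)" "to_fract (cyclotomic d)" \<q> d "d div 2"
      using odd(1) d(2) by (rule cyclotomic_localization_cyclotomic)
    have S: "D.cgr 1 ?S 0"
      unfolding T_def using odd(2) assms(3) unfolding m by (rule D.sum_T_eq_0)
    \<comment> \<open>The right-hand side vanishes through [n], as \<open>d\<close> divides
      \<open>n\<close> and \<open>1 - \<q>\<close> is a unit for \<open>d > 1\<close>.\<close>
    have "D.cgr 1 ((1 - \<q> ^ n) / (1 - \<q>)) ((1 - 1) / (1 - \<q>))"
      using d(1) by (intro D.cgr_divide D.cgr_diff D.cgr_refl D.q_power_1) auto
    then have "D.cgr 1 ?W ((1 - 1) / (1 - \<q>) *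
        (1 / \<q> ^ h * (1 + (\<q> ^ n - 1)^2 * ((of_nat n ^ 2 - 1) / 24))) * (\<Sum>j\<le>h. b j))"
      unfolding b_def
      by (intro D.cgr_mult D.cgr_refl D.sum_in D.b_in' D.mult_in D.divide_in D.add_in) auto
    then have W: "D.cgr 1 ?W 0"
      by simp
    have "D.cgr 1 ?S ?W"
      using S W D.cgr_sym D.cgr_trans by blast
    then show "\<exists>z\<in>loc (cyclotomic d). ?S - ?W = to_fract (cyclotomic d) ^ 1 * z"
      by (simp only: D.cgr_def)
  next
    have "N.cgr 4 ?S (\<Sum>k\<le>h. T k)"
      using assms(3)
    proof
      assume "M = n - 1"
      with n have "{..M} = {..<n}" by auto
      then show ?thesis
        using N.sum_T_tail by (simp add: T_def)
    next
      assume "M = (n - 1) div 2"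
      then show ?thesis
        by (simp only: h(2) N.cgr_refl)
    qed
    also have "N.cgr 4 \<dots> ?W"
      unfolding T_def b_def by (rule N.sum_T_cong)
    finally show "\<exists>z\<in>loc (cyclotomic n). ?S - ?W = to_fract (cyclotomic n) ^ 4 * z"
      by (simp only: N.cgr_def)
  qed
qed

end
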